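(* Let $\epsilon,\delta\in(0,1)$, $\gamma\in(0,1)$, and let the policies satisfy $B<\infty$. Then for every $n\ge 1$ the interval $\hat C_{\tilde\tau}$ produced by the known-behavior-policy procedure described in the context is an $(\epsilon,\delta)$-PAC prediction interval of $R_{n+1}$, i.e. $$\mathbb P\big[L_{P^{\pi_e}}(\hat C_{\tilde\tau})\le \epsilon\big]\ \ge\ 1-\delta .$$
   Context: Setting. $\mathcal S$ (contexts) and $\mathcal A$ (actions) are measurable spaces; rewards are real. A policy $\pi$ maps each $s\in\mathcal S$ to a probability distribution $\pi(\cdot\mid s)$ on $\mathcal A$; $\pi(a\mid s)$ denotes its density (or mass function) with respect to a fixed reference measure $\mathrm da$. $P_S$ is a distribution on $\mathcal S$ and $P_R(\cdot\mid s,a)$ is a conditional reward distribution on $\mathbb R$. The behavior policy $\pi_b$ and the target policy $\pi_e$ are given. The data $\mathcal D=\{(S_i,A_i,R_i)\}_{i=1}^n$ are i.i.d. with $S_i\sim P_S$, $A_i\mid S_i\sim \pi_b(\cdot\mid S_i)$, $R_i\mid (S_i,A_i)\sim P_R(\cdot\mid S_i,A_i)$. The target distribution $P^{\pi_e}$ on $\mathcal S\times\mathbb R$ is the law of $(S,R)$ when $S\sim P_S$, $A\mid S\sim\pi_e(\cdot\mid S)$, $R\mid(S,A)\sim P_R(\cdot\mid S,A)$. The test pair $(S_{n+1},R_{n+1})\sim P^{\pi_e}$ is independent of everything used to build the interval. Put $w(s,a)=\pi_e(a\mid s)/\pi_b(a\mid s)$, with $w(s,a)=0$ if $\pi_e(a\mid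 s)=\pi_b(a\mid s)=0$, and $B=\inf\{b:\pi_e(a\mid s)\le b\,\pi_b(a\mid s)\text{ for all }(s,a)\}$. Known-behavior-policy procedure. 1. Rejection sampling: let $V_1,\dots,V_n$ be i.i.d. uniform on $[0,1]$, independent of $\mathcal D$. Let $\mathcal D_{\mathrm{rs}}$ consist of the pairs $(S_i,R_i)$ with $V_i\le w(S_i,A_i)/B$, listed in increasing order of $i$; $N_{\mathrm{rs}}$ is their number. 2. Split: $\mathcal D_{\mathrm{rs}}$ is split into $\mathcal D^{\mathrm{rs}}_1$ (training) of size $N_{\mathrm{rs}}-M$ and $\mathcal D^{\mathrm{rs}}_2$ (calibration) of size $M=\lceil\gamma N_{\mathrm{rs}}\rceil$; the choice of positions does not depend on the values of the data points. 3. Training: fix quantile levels $\epsilon_{\mathrm{lo}},\epsilon_{\mathrm{up}}\in[0,1]$ with $\epsilon_{\mathrm{up}}-\epsilon_{\mathrm{lo}}=1-\epsilon$. An arbitrary fixed algorithm without extra randomness maps $\mathcal D^{\mathrm{rs}}_1$ to measurable functions $\hat q_{\epsilon_{\mathrm{lo}}},\hat q_{\epsilon_{\mathrm{up}}}:\mathcal S\to\mathbb R$ (estimates of the conditional quantiles of $R$ given $S$). For $\tau\in\mathbb R\cup\{\infty\}$ put $\hat C_\tau(s)=[\hat q_{\epsilon_{\mathrm{lo}}}(s)-\tau,\ \hat q_{\epsilon_{\mathrm{up}}}(s)+\tau]$ (empty if the lower endpoint exceeds the upper; equal to $\mathbb R$ if $\tau=\infty$). 4. Calibration: for $(S_i,R_i)\in\mathcal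 D^{\mathrm{rs}}_2$ put $\tau_i=\max\{\hat q_{\epsilon_{\mathrm{lo}}}(S_i)-R_i,\ R_i-\hat q_{\epsilon_{\mathrm{up}}}(S_i)\}$; let $\tau_{(1)}\le\dots\le\tau_{(M)}$ be the ordered values and $\tau_{(M+1)}=\infty$. With $F_{\mathrm{Bin}(M,\epsilon)}$ the binomial c.d.f., let $k(M,\epsilon,\delta)=\max\{k\in\{-1,0,\dots,M-1\}: F_{\mathrm{Bin}(M,\epsilon)}(k)\le\delta\}$ (where $F_{\mathrm{Bin}(M,\epsilon)}(-1)=0$). Set $\tilde\tau=\tau_{(M-k(M,\epsilon,\delta))}$. The output is $\hat C_{\tilde\tau}$. Miscoverage. $L_{P^{\pi_e}}(\hat C)$ is the conditional probability that $R_{n+1}\notin\hat C(S_{n+1})$ given everything used to construct $\hat C$ (i.e. $\mathcal D$, the $V_i$ and the split); it is a random variable. The outer probability $\mathbb P$ is over all this randomness. *)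

theory Defs
  imports "HOL-Probability.Probability"
begin

section \<open>Policies and laws of the data\<close>

text \<open>A policy is a Markov kernel \<open>\<pi>\<close> from contexts to actions; \<open>p s a\<close> is a (jointly measurable)
  version of its density with respect to the reference measure \<open>AS\<close>, whose \<open>\<sigma>\<close>-algebra is
  that of the action space. No \<open>\<sigma>\<close>-finiteness of \<open>AS\<close> is required.\<close>

definition policy_with_density ::
  "'s measure \<Rightarrow> 'a measure \<Rightarrow> ('s \<Rightarrow> 'a measure) \<Rightarrow> ('s \<Rightarrow> 'a \<Rightarrow> real) \<Rightarrow> bool" where
  "policy_with_density CS AS \<pi> p \<longleftrightarrow>
     \<pi> \<in> CS \<rightarrow>\<^sub>M prob_algebra AS \<and>
     (\<lambda>(s, a). p s a) \<in> borel_measurable (CS \<Otimes>\<^sub>M AS) \<and>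
     (\<forall>s\<in>space CS. \<forall>a\<in>space AS. 0 \<le> p s a) \<and>
     (\<forall>s\<in>space CS. \<pi> s = density AS (\<lambda>a. ennreal (p s a)))"

abbreviation obs_space :: "'s measure \<Rightarrow> 'a measure \<Rightarrow> ('s \<times> 'a \<times> real) measure" where
  "obs_space CS AS \<equiv> CS \<Otimes>\<^sub>M (AS \<Otimes>\<^sub>M borel)"

definition obs_law ::
  "'s measure \<Rightarrow> 'a measure \<Rightarrow> 's measure \<Rightarrow> ('s \<times> 'a \<Rightarrow> real measure) \<Rightarrow> ('s \<Rightarrow> 'a measure)
     \<Rightarrow> ('s \<times> 'a \<times> real) measure" where
  "obs_law CS AS PS PR \<pi> =
     PS \<bind> (\<lambda>s. \<pi> s \<bind> (\<lambda>a. PR (s, a) \<bind> (\<lambda>r. return (obs_space CS AS) (s, a, r))))"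

definition target_law ::
  "'s measure \<Rightarrow> 'a measure \<Rightarrow> 's measure \<Rightarrow> ('s \<times> 'a \<Rightarrow> real measure) \<Rightarrow> ('s \<Rightarrow> 'a measure)
     \<Rightarrow> ('s \<times> real) measure" where
  "target_law CS AS PS PR \<pi> =
     distr (obs_law CS AS PS PR \<pi>) (CS \<Otimes>\<^sub>M borel) (\<lambda>(s, a, r). (s, r))"

section \<open>Independence of random elements of different types\<close>

text \<open>The constant \<open>indep_var\<close> requires both variables to have the same value type; this is
  the characterization \<open>indep_var_eq\<close> without that restriction.\<close>

definition indep_elements ::
  "'w measure \<Rightarrow> 'x measure \<Rightarrow> ('w \<Rightarrow> 'x) \<Rightarrow> 'y measure \<Rightarrow> ('w \<Rightarrow> 'y) \<Rightarrow> bool" where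
  "indep_elements \<Omega> MX X MY Y \<longleftrightarrow>
     X \<in> \<Omega> \<rightarrow>\<^sub>M MX \<and> Y \<in> \<Omega> \<rightarrow>\<^sub>M MY \<and>
     prob_space.indep_set \<Omega>
       (sets (vimage_algebra (space \<Omega>) X MX)) (sets (vimage_algebra (space \<Omega>) Y MY))"

section \<open>Rejection sampling\<close>

definition importance_weight ::
  "('s \<Rightarrow> 'a \<Rightarrow> real) \<Rightarrow> ('s \<Rightarrow> 'a \<Rightarrow> real) \<Rightarrow> 's \<Rightarrow> 'a \<Rightarrow> real" where
  "importance_weight pe pb s a =
     (if pe s a = 0 \<and> pb s a = 0 then 0 else pe s a / pb s a)"

text \<open>The infimum is taken in the extended reals, so that it is \<open>\<infinity>\<close> if there is no real bound.\<close>

definition weight_bound ::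
  "'s measure \<Rightarrow> 'a measure \<Rightarrow> ('s \<Rightarrow> 'a \<Rightarrow> real) \<Rightarrow> ('s \<Rightarrow> 'a \<Rightarrow> real) \<Rightarrow> ereal" where
  "weight_bound CS AS pe pb =
     Inf (ereal ` {b. \<forall>s\<in>space CS. \<forall>a\<in>space AS. pe s a \<le> b * pb s a})"

definition rejection_sample ::
  "nat \<Rightarrow> ('s \<Rightarrow> 'a \<Rightarrow> real) \<Rightarrow> real \<Rightarrow> (nat \<Rightarrow> 's \<times> 'a \<times> real) \<Rightarrow> (nat \<Rightarrow> real) \<Rightarrow> ('s \<times> real) list" where
  "rejection_sample n w B d v =
     map (\<lambda>i. case d i of (s, a, r) \<Rightarrow> (s, r))
       (filter (\<lambda>i. case d i of (s, a, r) \<Rightarrow> v i \<le> w s a / B) [0..<n])"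

section \<open>Training and splitting\<close>

text \<open>A training algorithm maps a list of context-reward pairs to a real function on the context
  space. Measurability is joint in the training data (for each size \<open>m\<close> of the training set)
  and the context.\<close>

definition measurable_algorithm ::
  "'s measure \<Rightarrow> (('s \<times> real) list \<Rightarrow> 's \<Rightarrow> real) \<Rightarrow> bool" where
  "measurable_algorithm CS q \<longleftrightarrow>
     (\<forall>m. (\<lambda>(x, s). q (map x [0..<m]) s)
        \<in> borel_measurable ((\<Pi>\<^sub>M i\<in>{..<m}. CS \<Otimes>\<^sub>M borel) \<Otimes>\<^sub>M CS))"

text \<open>\<open>pos m u\<close> is the set of calibration positions in a list of length \<open>m\<close>, where \<open>u\<close> is a random
  seed; a deterministic split is one that ignores \<open>u\<close>.\<close>

definition split_rule :: "real \<Rightarrow> 'u measure \<Rightarrow> (nat \<Rightarrow> 'u \<Rightarrow> nat set) \<Rightarrow> bool" where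
  "split_rule \<gamma> MU pos \<longleftrightarrow>
     (\<forall>m. pos m \<in> MU \<rightarrow>\<^sub>M count_space {J. J \<subseteq> {..<m} \<and> card J = nat \<lceil>\<gamma> * real m\<rceil>})"

section \<open>Calibration and prediction interval\<close>

definition conformity_score :: "('s \<Rightarrow> real) \<Rightarrow> ('s \<Rightarrow> real) \<Rightarrow> 's \<times> real \<Rightarrow> real" where
  "conformity_score qlo qup = (\<lambda>(s, r). max (qlo s - r) (r - qup s))"

text \<open>The binomial distribution function at \<open>-1\<close> is the probability of the empty set.\<close>

definition pac_index :: "nat \<Rightarrow> real \<Rightarrow> real \<Rightarrow> int" where
  "pac_index M \<epsilon> \<delta> =
     Max {k \<in> {-1..int M - 1}. measure_pmf.prob (binomial_pmf M \<epsilon>) {j. int j \<le> k} \<le> \<delta>}"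

text \<open>Order statistics are counted from \<open>1\<close>; the one after the last is \<open>\<infinity>\<close>.\<close>

definition order_statistic :: "real list \<Rightarrow> nat \<Rightarrow> ereal" where
  "order_statistic ts j = (if j \<le> length ts then ereal (sort ts ! (j - 1)) else \<infinity>)"

definition pac_threshold :: "real \<Rightarrow> real \<Rightarrow> real list \<Rightarrow> ereal" where
  "pac_threshold \<epsilon> \<delta> ts =
     order_statistic ts (nat (int (length ts) - pac_index (length ts) \<epsilon> \<delta>))"

definition prediction_interval :: "('s \<Rightarrow> real) \<Rightarrow> ('s \<Rightarrow> real) \<Rightarrow> ereal \<Rightarrow> 's \<Rightarrow> real set" where
  "prediction_interval qlo qup \<tau> s =
     {r. ereal r \<in> {ereal (qlo s) - \<tau> .. ereal (qup s) + \<tau>}}"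

text \<open>The interval computed from a sample \<open>xs\<close> with calibration positions \<open>J\<close>;
  \<open>qhat e\<close> is the training algorithm for the quantile level \<open>e\<close>.\<close>

definition pac_interval ::
  "(real \<Rightarrow> ('s \<times> real) list \<Rightarrow> 's \<Rightarrow> real) \<Rightarrow> real \<Rightarrow> real \<Rightarrow> real \<Rightarrow> real
     \<Rightarrow> ('s \<times> real) list \<Rightarrow> nat set \<Rightarrow> 's \<Rightarrow> real set" where
  "pac_interval qhat \<epsilon>lo \<epsilon>up \<epsilon> \<delta> xs J =
     (let train = nths xs (- J);
          calib = nths xs J;
          qlo = qhat \<epsilon>lo train;
          qup = qhat \<epsilon>up train
      in prediction_interval qlo qup (pac_threshold \<epsilon> \<delta> (map (conformity_score qlo qup) calib)))"

definition procedure_interval ::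
  "nat \<Rightarrow> ('s \<Rightarrow> 'a \<Rightarrow> real) \<Rightarrow> real \<Rightarrow> (real \<Rightarrow> ('s \<times> real) list \<Rightarrow> 's \<Rightarrow> real)
     \<Rightarrow> (nat \<Rightarrow> 'u \<Rightarrow> nat set) \<Rightarrow> real \<Rightarrow> real \<Rightarrow> real \<Rightarrow> real
     \<Rightarrow> (nat \<Rightarrow> 's \<times> 'a \<times> real) \<Rightarrow> (nat \<Rightarrow> real) \<Rightarrow> 'u \<Rightarrow> 's \<Rightarrow> real set" where
  "procedure_interval n w B qhat pos \<epsilon>lo \<epsilon>up \<epsilon> \<delta> d v u =
     (let xs = rejection_sample n w B d v
      in pac_interval qhat \<epsilon>lo \<epsilon>up \<epsilon> \<delta> xs (pos (length xs) u))"

section \<open>Miscoverage\<close>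

text \<open>The conditional probability that the test pair \<open>T\<close> is not covered by the random set-valued
  map \<open>C\<close>, given the random element \<open>Z\<close> (with values in \<open>MZ\<close>) from which \<open>C\<close> is computed. It is
  determined up to a null set.\<close>

definition miscoverage ::
  "'w measure \<Rightarrow> 'z measure \<Rightarrow> ('w \<Rightarrow> 'z) \<Rightarrow> ('w \<Rightarrow> 's \<times> real) \<Rightarrow> ('w \<Rightarrow> 's \<Rightarrow> real set)
     \<Rightarrow> 'w \<Rightarrow> real" where
  "miscoverage \<Omega> MZ Z T C =
     real_cond_exp \<Omega> (vimage_algebra (space \<Omega>) Z MZ)
       (indicator {\<omega> \<in> space \<Omega>. snd (T \<omega>) \<notin> C \<omega> (fst (T \<omega>))})"

end

theory Submission
  imports Defs
begin

text \<open>No conditional law given the acceptance pattern is ever formed. The part of a pattern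
  where the miscoverage exceeds \<epsilon> is compared with \<delta> times the whole pattern, and
  both carry the same factor: one acceptance probability \<open>1 / B\<close> for each calibration
  coordinate. The sample size, and with it \<open>M\<close> and \<open>k\<close>, is random, but it
  is constant on a pattern; so the binomial bound is needed for every \<open>M\<close>, and summing
  over the disjoint patterns loses nothing. The quantile can be chosen only after the training
  coordinates are frozen, since the score depends on them; in a product measure freezing them leaves
  the calibration coordinates i.i.d. Two inequalities describe the quantile because the score may
  have atoms: the strict one controls miscoverage, the weak one the success probability. Finally,
  miscoverage is a conditional expectation and so fixed only up to null sets; it is traded for the
  measure of a section of one jointly measurable event, to which Fubini applies.\<close>

text \<open>Since \<open>\<pi>\<^sub>e\<close> has density \<open>w\<close> with respect to \<open>\<pi>\<^sub>b\<close>, rejection sampling accepts an observation with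
  \<open>(S, R) \<in> E\<close> with probability \<open>P(E) / B\<close>, where \<open>P\<close> is the target law; so given the acceptance
  pattern the retained pairs are independent with law \<open>P\<close>. Freeze the split, the acceptance pattern and
  the training data, and let \<open>t\<close> be an upper \<open>\<epsilon>\<close>-quantile of the resulting score under \<open>P\<close>, that is
  \<open>P(score > t) \<le> \<epsilon> \<le> P(score \<ge> t)\<close>. If the miscoverage exceeds \<open>\<epsilon>\<close>, then the threshold
  \<open>\<tau>(M - k)\<close> lies below \<open>t\<close>, that is at most \<open>k\<close> of the \<open>M\<close> calibration scores are \<open>\<ge> t\<close>. As each of them
  is with probability at least \<open>\<epsilon>\<close>, this has probability at most \<open>F\<^sub>B\<^sub>i\<^sub>n(k) \<le> \<delta>\<close>.\<close>

section \<open>Quantiles, order statistics and the binomial index\<close>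

text \<open>Condition on one trial: a success leaves room for one success fewer. Counting strictly
  below \<open>c\<close> makes \<open>c = 0\<close> the value of the distribution function at
  -1.\<close>

lemma prob_binomial_Suc_lessThan:
  assumes "0 \<le> p" "p \<le> 1"
  shows "measure_pmf.prob (binomial_pmf (Suc n) p) {..<Suc c} =
    p * measure_pmf.prob (binomial_pmf n p) {..<c}
    + (1 - p) * measure_pmf.prob (binomial_pmf n p) {..<Suc c}"
proof -
  have "binomial_pmf (Suc n) p =
      bernoulli_pmf p \<bind> (\<lambda>b. map_pmf ((+) (if b then 1 else 0)) (binomial_pmf n p))"
    using assms by (simp add: binomial_pmf_Suc map_pmf_def)
  then have "emeasure (binomial_pmf (Suc n) p) {..<Suc c} =
      (\<integral>\<^sup>+ b. emeasure (binomial_pmf n p) ((+) (if b then 1 else 0) -` {..<Suc c}) \<partial>bernoulli_pmf p)"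
    by simp
  moreover have "(+) 1 -` {..<Suc c} = {..<c}" by auto
  moreover have "(+) 0 -` {..<Suc c} = {..<Suc c}" by auto
  ultimately show ?thesis
    using assms
    by (simp add: measure_pmf.emeasure_eq_measure flip: ennreal_mult ennreal_plus)
qed

text \<open>The generalized inverse of the distribution function at 1 - \<epsilon> works. If
  \<open>f\<close> has an atom at \<open>t\<close>, the two probabilities differ and \<epsilon> may
  lie strictly between them.\<close>

lemma exists_quantile:
  fixes f :: "'x \<Rightarrow> real"
  assumes "prob_space P" and f[measurable]: "f \<in> borel_measurable P" and "0 < \<epsilon>" "\<epsilon> < 1"
  obtains t where "measure P {x\<in>space P. t < f x} \<le> \<epsilon>" "\<epsilon> \<le> measure P {x\<in>space P. t \<le> f x}"
proof -
  interpret P: prob_space P by fact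
  interpret F: cdf_distribution "distr P borel f"
    by (simp add: cdf_distribution_def P.real_distribution_distr)
  define t where "t = F.I (1 - \<epsilon>)"
  have *: "1 - \<epsilon> \<le> F.C x \<longleftrightarrow> t \<le> x" for x
    unfolding t_def using assms by (intro F.pseudoinverse) auto
  have C: "F.C x = 1 - measure P {y\<in>space P. x < f y}" for x
  proof -
    have "F.C x = measure P {y\<in>space P. f y \<le> x}"
      by (simp add: cdf_def measure_distr vimage_def Int_def conj_commute)
    also have "\<dots> = measure P (space P - {y\<in>space P. x < f y})"
      by (intro arg_cong[where f="measure P"]) auto
    finally show ?thesis by (simp add: P.prob_compl)
  qed
  have 1: "measure P {x\<in>space P. t < f x} \<le> \<epsilon>" using *[of t] C[of t] by simp
  \<comment> \<open>Every x < t satisfies F(x) < 1 - \<epsilon>, hence P(f > x) > \<epsilon>.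
    Letting x increase to \<open>t\<close> turns the strict event into the weak one, by continuity
    from above.\<close>
  have "(\<lambda>n. measure P {y\<in>space P. t - 1 / Suc n < f y}) \<longlonglongrightarrow> measure P (\<Inter>n. {y\<in>space P. t - 1 / Suc n < f y})"
    by (intro P.finite_Lim_measure_decseq)
       (auto simp: decseq_def intro: less_le_trans[rotated] le_less_trans[rotated] simp: frac_le diff_mono)
  moreover have "(\<Inter>n. {y\<in>space P. t - 1 / Suc n < f y}) = {y\<in>space P. t \<le> f y}"
  proof (intro set_eqI iffI)
    fix y assume y: "y \<in> (\<Inter>n. {y\<in>space P. t - 1 / Suc n < f y})"
    have "t \<le> f y"
    proof (rule ccontr)
      assume "\<not> t \<le> f y"
      then obtain n where "inverse (of_nat (Suc n)) < t - f y"
        using reals_Archimedean[of "t - f y"] by auto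
      moreover have "t - 1 / Suc n < f y" using y by blast
      ultimately show False by (simp add: inverse_eq_divide)
    qed
    then show "y \<in> {y\<in>space P. t \<le> f y}" using y by auto
  next
    fix y assume "y \<in> {y\<in>space P. t \<le> f y}"
    then have "y \<in> space P" "t \<le> f y" by auto
    moreover have "t - 1 / Suc n < f y" for n
      using \<open>t \<le> f y\<close> by (rule less_le_trans[rotated]) simp
    ultimately show "y \<in> (\<Inter>n. {y\<in>space P. t - 1 / Suc n < f y})" by auto
  qed
  ultimately have "(\<lambda>n. measure P {y\<in>space P. t - 1 / Suc n < f y}) \<longlonglongrightarrow> measure P {y\<in>space P. t \<le> f y}"
    by simp
  moreover have "\<epsilon> \<le> measure P {y\<in>space P. t - 1 / Suc n < f y}" for n
    using *[of "t - 1 / Suc n"] C[of "t - 1 / Suc n"] by (simp add: not_le[symmetric])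
  ultimately have "\<epsilon> \<le> measure P {y\<in>space P. t \<le> f y}"
    by (intro LIMSEQ_le_const) auto
  then show ?thesis using that 1 by blast
qed

text \<open>In a sorted list the entries below \<open>x\<close> form a prefix, and sorting does not
  change their number. Places count from 0 here.\<close>

lemma sort_nth_less_iff:
  fixes ts :: "'x::linorder list"
  assumes "j < length ts"
  shows "sort ts ! j < x \<longleftrightarrow> j < length (filter (\<lambda>t. t < x) ts)"
proof -
  define ss where "ss = sort ts"
  have "mset (filter (\<lambda>t. t < x) ts) = mset (filter (\<lambda>t. t < x) ss)" by (simp add: ss_def)
  then have len: "length (filter (\<lambda>t. t < x) ts) = length (filter (\<lambda>t. t < x) ss)"
    by (metis mset_eq_length)
  have ss: "sorted ss" "j < length ss" using assms by (simp_all add: ss_def)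
  have "length (filter (\<lambda>t. t < x) ss) = length (takeWhile (\<lambda>t. t < x) ss)"
    using filter_equals_takeWhile_sorted_rev[of "\<lambda>t. t"] ss(1)
    by (induction ss) (auto simp: filter_empty_conv leD order.strict_trans1)
  moreover have "ss ! j < x \<longleftrightarrow> j < length (takeWhile (\<lambda>t. t < x) ss)"
  proof
    assume "ss ! j < x"
    then have "\<forall>i<Suc j. ss ! i < x"
      using ss sorted_nth_mono[OF ss(1)] by (metis less_Suc_eq_le order.strict_trans1)
    then show "j < length (takeWhile (\<lambda>t. t < x) ss)"
      using ss(2) nth_length_takeWhile[of "\<lambda>t. t < x" ss] by (meson less_Suc_eq_le not_less order.strict_trans1)
  next
    assume "j < length (takeWhile (\<lambda>t. t < x) ss)"
    then show "ss ! j < x"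
      by (metis nth_mem set_takeWhileD takeWhile_nth)
  qed
  ultimately show ?thesis using len by (simp add: ss_def)
qed

text \<open>The maximum is attained: its range is finite and contains -1, because the empty event
  has probability 0. Counting strictly below k + 1 turns k = -1 into an empty range of
  naturals.\<close>

lemma pac_index:
  assumes "0 \<le> \<delta>"
  shows "-1 \<le> pac_index M \<epsilon> \<delta>" "pac_index M \<epsilon> \<delta> \<le> int M - 1"
    "measure_pmf.prob (binomial_pmf M \<epsilon>) {..<nat (pac_index M \<epsilon> \<delta> + 1)} \<le> \<delta>"
proof -
  let ?S = "{k \<in> {-1..int M - 1}. measure_pmf.prob (binomial_pmf M \<epsilon>) {j. int j \<le> k} \<le> \<delta>}"
  have "{j. int j \<le> -1} = {}" by auto
  then have "-1 \<in> ?S" using assms by simp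
  moreover have "finite ?S" by (rule finite_subset[of _ "{-1..int M - 1}"]) auto
  ultimately have "pac_index M \<epsilon> \<delta> \<in> ?S" unfolding pac_index_def by (intro Max_in) auto
  moreover from this have "{j. int j \<le> pac_index M \<epsilon> \<delta>} = {..<nat (pac_index M \<epsilon> \<delta> + 1)}" by auto
  ultimately show "-1 \<le> pac_index M \<epsilon> \<delta>" "pac_index M \<epsilon> \<delta> \<le> int M - 1"
    "measure_pmf.prob (binomial_pmf M \<epsilon>) {..<nat (pac_index M \<epsilon> \<delta> + 1)} \<le> \<delta>" by auto
qed

text \<open>Widening both endpoints by the threshold covers \<open>r\<close> exactly if the score of
  \<open>(s, r)\<close> does not exceed the threshold; this includes the case of an empty interval.
  What remains is a count of calibration scores below that score.\<close>

lemma not_in_prediction_interval_iff: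
  fixes ts :: "real list"
  assumes "0 \<le> \<delta>"
  shows "r \<notin> prediction_interval qlo qup (pac_threshold \<epsilon> \<delta> ts) s \<longleftrightarrow>
    length ts < length (filter (\<lambda>t. t < conformity_score qlo qup (s, r)) ts)
      + nat (pac_index (length ts) \<epsilon> \<delta> + 1)"
proof -
  define M where "M = length ts"
  define c where "c = nat (pac_index M \<epsilon> \<delta> + 1)"
  have c: "nat (int M - pac_index M \<epsilon> \<delta>) = M + 1 - c" "c \<le> M"
    using pac_index(1,2)[OF assms, of M \<epsilon>] by (auto simp: c_def)
  show ?thesis
  proof (cases "c = 0")
    case True
    \<comment> \<open>Here k = -1: the requested place M + 1 lies past the end, the threshold is
      infinite, and no count can exceed \<open>M\<close>.\<close>
    then show ?thesis using c length_filter_le[of _ ts]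
      by (auto simp: pac_threshold_def order_statistic_def M_def[symmetric] c_def[symmetric] prediction_interval_def not_less)
  next
    case False
    \<comment> \<open>Place M + 1 - c counted from 1 is the entry \<open>M - c\<close> counted from
      0.\<close>
    then have lt: "M - c < length ts" using c by (simp add: M_def)
    have "r \<notin> prediction_interval qlo qup (pac_threshold \<epsilon> \<delta> ts) s \<longleftrightarrow>
      sort ts ! (M - c) < conformity_score qlo qup (s, r)"
      using False c
      by (auto simp: pac_threshold_def order_statistic_def M_def[symmetric] c_def[symmetric]
          prediction_interval_def conformity_score_def)
    also have "\<dots> \<longleftrightarrow> M - c < length (filter (\<lambda>t. t < conformity_score qlo qup (s, r)) ts)"
      by (rule sort_nth_less_iff[OF lt])
    finally show ?thesis using False c by (auto simp: M_def[symmetric] c_def[symmetric])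
  qed
qed

section \<open>Products of probability spaces and conditional probabilities\<close>

text \<open>Measurability of a random count is read off from the sum of indicators.\<close>

lemma count_sum_indicator: "finite K \<Longrightarrow> card {i\<in>K. z i \<in> H} = (\<Sum>i\<in>K. indicator H (z i))"
  by (simp add: indicator_def sum.If_cases Int_def)

text \<open>Only a lower bound on the success probability is assumed: conditioning on the last coordinate
  compares directly with the binomial recursion, so no stochastic dominance between binomial laws
  is needed.\<close>

lemma prob_PiM_count_less_le_binomial:
  fixes K :: "'i set"
  assumes "prob_space Q" "finite K"
    and [measurable]: "G \<in> sets Q" "H \<in> sets Q" and "H \<subseteq> G"
    and \<epsilon>: "0 \<le> \<epsilon>" "\<epsilon> \<le> 1" "\<epsilon> * measure Q G \<le> measure Q H"
  shows "measure (PiM K (\<lambda>_. Q))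
      {z\<in>space (PiM K (\<lambda>_. Q)). (\<forall>i\<in>K. z i \<in> G) \<and> card {i\<in>K. z i \<in> H} < c}
    \<le> measure Q G ^ card K * measure_pmf.prob (binomial_pmf (card K) \<epsilon>) {..<c}"
  using \<open>finite K\<close>
proof (induction K arbitrary: c rule: finite_induct)
  case empty
  interpret prob_space "PiM {} (\<lambda>_::'i. Q)" by (intro prob_space_PiM assms)
  show ?case
    using prob_space \<epsilon>(1,2) by (cases c) (simp_all add: binomial_pmf_0)
next
  case (insert i K)
  interpret Q: prob_space Q by fact
  interpret PS: product_prob_space "\<lambda>_::'i. Q" UNIV by unfold_locales
  interpret PK: prob_space "PiM K (\<lambda>_. Q)" by (intro prob_space_PiM assms)
  interpret PiK: prob_space "PiM (insert i K) (\<lambda>_. Q)" by (intro prob_space_PiM assms)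
  define A where "A K c = {z\<in>space (PiM K (\<lambda>_. Q)). (\<forall>i\<in>K. z i \<in> G) \<and> card {i\<in>K. z i \<in> H} < c}"
    for K :: "'i set" and c
  have A[measurable]: "A K c \<in> sets (PiM K (\<lambda>_. Q))" if "finite K" for K c
  proof -
    have "A K c = {z\<in>space (PiM K (\<lambda>_. Q)). (\<forall>i\<in>K. z i \<in> G) \<and> (\<Sum>i\<in>K. indicator H (z i)::nat) < c}"
      using that by (simp add: A_def count_sum_indicator)
    also have "\<dots> \<in> sets (PiM K (\<lambda>_. Q))" using that by measurable
    finally show ?thesis .
  qed
  show ?case
  proof (cases c)
    case 0
    then show ?thesis by simp
  next
    case (Suc c')
    let ?P = "\<lambda>c. measure (PiM K (\<lambda>_. Q)) (A K c)"
    let ?b = "\<lambda>n c. measure_pmf.prob (binomial_pmf n \<epsilon>) {..<c}"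
    \<comment> \<open>The new coordinate either lies in \<open>H\<close> and uses up one of the
      allowed successes, or lies in \<open>G - H\<close> and uses none; outside \<open>G\<close>
      both terms vanish.\<close>
    have ind: "indicator (A (insert i K) (Suc c')) (x(i := y)) =
        (indicator (A K c') x * indicator H y + indicator (A K (Suc c')) x * indicator (G - H) y :: ennreal)"
      if x: "x \<in> space (PiM K (\<lambda>_. Q))" and y: "y \<in> space Q" for x y
    proof -
      have "x(i := y) \<in> space (PiM (insert i K) (\<lambda>_. Q))"
        using x y by (auto simp: space_PiM PiE_def extensional_def)
      moreover have "{j\<in>insert i K. (x(i := y)) j \<in> H} =
          (if y \<in> H then insert i {j\<in>K. x j \<in> H} else {j\<in>K. x j \<in> H})"
        using insert.hyps by auto
      moreover have "(\<forall>j\<in>insert i K. (x(i := y)) j \<in> G) \<longleftrightarrow> y \<in> G \<and> (\<forall>j\<in>K. x j \<in> G)"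
        using insert.hyps by auto
      ultimately show ?thesis
        using x y insert.hyps \<open>H \<subseteq> G\<close> by (auto simp: A_def indicator_def)
    qed
    have "emeasure (PiM (insert i K) (\<lambda>_. Q)) (A (insert i K) (Suc c')) =
        (\<integral>\<^sup>+ x. \<integral>\<^sup>+ y. indicator (A (insert i K) (Suc c')) (x(i := y)) \<partial>Q \<partial>PiM K (\<lambda>_. Q))"
      using insert.hyps A[of "insert i K" "Suc c'"]
      by (simp add: PS.product_nn_integral_insert[symmetric] del: nn_integral_indicator)
         (simp add: nn_integral_indicator)
    also have "\<dots> = (\<integral>\<^sup>+ x. \<integral>\<^sup>+ y. indicator (A K c') x * indicator H y
        + indicator (A K (Suc c')) x * indicator (G - H) y \<partial>Q \<partial>PiM K (\<lambda>_. Q))"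
      by (intro nn_integral_cong ind)
    also have "\<dots> = (\<integral>\<^sup>+ x. indicator (A K c') x * emeasure Q H
        + indicator (A K (Suc c')) x * emeasure Q (G - H) \<partial>PiM K (\<lambda>_. Q))"
      by (simp add: nn_integral_add nn_integral_cmult)
    also have "\<dots> = emeasure (PiM K (\<lambda>_. Q)) (A K c') * emeasure Q H
        + emeasure (PiM K (\<lambda>_. Q)) (A K (Suc c')) * emeasure Q (G - H)"
      using A[OF insert.hyps(1)] by (simp add: nn_integral_add nn_integral_multc)
    finally have "measure (PiM (insert i K) (\<lambda>_. Q)) (A (insert i K) (Suc c')) =
        ?P c' * measure Q H + ?P (Suc c') * measure Q (G - H)"
      by (simp add: PK.emeasure_eq_measure PiK.emeasure_eq_measure Q.emeasure_eq_measure
          flip: ennreal_mult ennreal_plus)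
    also have "measure Q (G - H) = measure Q G - measure Q H"
      using \<open>H \<subseteq> G\<close> by (intro Q.finite_measure_Diff) auto
    \<comment> \<open>Collecting the terms in \<open>measure Q H\<close> shows a nonpositive
      coefficient, since \<open>?P\<close> increases with the count. Hence the lower bound on
      \<open>measure Q H\<close> gives an upper bound for the whole.\<close>
    also have "?P c' * measure Q H + ?P (Suc c') * (measure Q G - measure Q H) =
        ?P (Suc c') * measure Q G - (?P (Suc c') - ?P c') * measure Q H"
      by (simp add: algebra_simps)
    also have "\<dots> \<le> ?P (Suc c') * measure Q G - (?P (Suc c') - ?P c') * (\<epsilon> * measure Q G)"
    proof -
      have "?P c' \<le> ?P (Suc c')"
        using A[OF insert.hyps(1)] by (intro PK.finite_measure_mono) (auto simp: A_def)
      then show ?thesis using \<epsilon> by (intro diff_left_mono mult_left_mono) auto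
    qed
    also have "\<dots> = measure Q G * (\<epsilon> * ?P c' + (1 - \<epsilon>) * ?P (Suc c'))"
      by (simp add: algebra_simps)
    also have "\<dots> \<le> measure Q G * (\<epsilon> * (measure Q G ^ card K * ?b (card K) c')
        + (1 - \<epsilon>) * (measure Q G ^ card K * ?b (card K) (Suc c')))"
      using insert.IH[of c'] insert.IH[of "Suc c'"] \<epsilon>(1,2)
      by (intro mult_left_mono add_mono) (auto simp: A_def)
    also have "\<dots> = measure Q G ^ card (insert i K) * ?b (card (insert i K)) (Suc c')"
      using insert.hyps by (simp add: prob_binomial_Suc_lessThan[OF \<epsilon>(1,2)] algebra_simps)
    finally show ?thesis by (simp add: A_def Suc)
  qed
qed

text \<open>Data and uniform variables are given as two independent families, whereas rejection
  sampling needs i.i.d. pairs. It suffices to compare boxes: a section of a box is a box of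
  sections, so Fubini yields a product of integrals.\<close>

lemma distr_PiM_pair_zip:
  fixes I :: "'i set"
  assumes "finite I" "prob_space M" "prob_space N"
  shows "distr (PiM I (\<lambda>_. M) \<Otimes>\<^sub>M PiM I (\<lambda>_. N)) (PiM I (\<lambda>_. M \<Otimes>\<^sub>M N)) (\<lambda>(x, y). \<lambda>i\<in>I. (x i, y i))
    = PiM I (\<lambda>_. M \<Otimes>\<^sub>M N)"
proof -
  interpret M: prob_space M by fact
  interpret N: prob_space N by fact
  interpret MN: pair_prob_space M N ..
  interpret PM: product_prob_space "\<lambda>_::'i. M" UNIV by unfold_locales
  interpret PN: product_prob_space "\<lambda>_::'i. N" UNIV by unfold_locales
  interpret PMN: product_prob_space "\<lambda>_::'i. M \<Otimes>\<^sub>M N" UNIV by unfold_locales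
  interpret IM: prob_space "PiM I (\<lambda>_. M)" by (intro prob_space_PiM assms)
  interpret IN: prob_space "PiM I (\<lambda>_. N)" by (intro prob_space_PiM assms)
  note [simp] = \<open>finite I\<close>
  let ?z = "\<lambda>(x, y). \<lambda>i\<in>I. (x i, y i)"
  have z[measurable]: "?z \<in> PiM I (\<lambda>_. M) \<Otimes>\<^sub>M PiM I (\<lambda>_. N) \<rightarrow>\<^sub>M PiM I (\<lambda>_. M \<Otimes>\<^sub>M N)"
    by measurable
  show ?thesis
  proof (rule PMN.PiM_eqI)
    fix A assume [measurable]: "\<And>i. i \<in> I \<Longrightarrow> A i \<in> sets (M \<Otimes>\<^sub>M N)"
    have box: "Pi\<^sub>E I A \<in> sets (PiM I (\<lambda>_. M \<Otimes>\<^sub>M N))" by (intro sets_PiM_I_finite) auto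
    have "emeasure (distr (PiM I (\<lambda>_. M) \<Otimes>\<^sub>M PiM I (\<lambda>_. N)) (PiM I (\<lambda>_. M \<Otimes>\<^sub>M N)) ?z) (Pi\<^sub>E I A) =
        emeasure (PiM I (\<lambda>_. M) \<Otimes>\<^sub>M PiM I (\<lambda>_. N))
          (?z -` Pi\<^sub>E I A \<inter> space (PiM I (\<lambda>_. M) \<Otimes>\<^sub>M PiM I (\<lambda>_. N)))"
      using box by (simp add: emeasure_distr)
    also have "\<dots> = (\<integral>\<^sup>+ x. emeasure (PiM I (\<lambda>_. N))
        (Pair x -` (?z -` Pi\<^sub>E I A \<inter> space (PiM I (\<lambda>_. M) \<Otimes>\<^sub>M PiM I (\<lambda>_. N)))) \<partial>PiM I (\<lambda>_. M))"
      using box by (intro IN.emeasure_pair_measure_alt) measurable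
    also have "\<dots> = (\<integral>\<^sup>+ x. (\<Prod>i\<in>I. emeasure N (Pair (x i) -` A i)) \<partial>PiM I (\<lambda>_. M))"
    proof (rule nn_integral_cong)
      fix x assume x: "x \<in> space (PiM I (\<lambda>_. M))"
      have "Pair x -` (?z -` Pi\<^sub>E I A \<inter> space (PiM I (\<lambda>_. M) \<Otimes>\<^sub>M PiM I (\<lambda>_. N))) =
          Pi\<^sub>E I (\<lambda>i. Pair (x i) -` A i)" (is "?L = ?R")
      proof -
        have "A i \<subseteq> space M \<times> space N" if "i \<in> I" for i
          using sets.sets_into_space[of "A i" "M \<Otimes>\<^sub>M N"] that by (auto simp: space_pair_measure)
        then show ?thesis
          using x by (auto simp: space_pair_measure space_PiM PiE_iff Pi_iff)
      qed
      then show "emeasure (PiM I (\<lambda>_. N)) ?L = (\<Prod>i\<in>I. emeasure N (Pair (x i) -` A i))"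
        by (simp add: PN.emeasure_PiM sets_Pair1)
    qed
    also have "\<dots> = (\<Prod>i\<in>I. \<integral>\<^sup>+ x. emeasure N (Pair x -` A i) \<partial>M)"
      by (intro PM.product_nn_integral_prod N.measurable_emeasure_Pair) auto
    also have "\<dots> = (\<Prod>i\<in>I. emeasure (M \<Otimes>\<^sub>M N) (A i))"
      by (intro prod.cong refl N.emeasure_pair_measure_alt[symmetric]) auto
    finally show "emeasure (distr (PiM I (\<lambda>_. M) \<Otimes>\<^sub>M PiM I (\<lambda>_. N)) (PiM I (\<lambda>_. M \<Otimes>\<^sub>M N)) ?z) (Pi\<^sub>E I A) =
      (\<Prod>i\<in>I. emeasure (M \<Otimes>\<^sub>M N) (A i))" .
  qed simp_all
qed

lemma distr_pair_indep_elements: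
  assumes "prob_space \<Omega>" and ind: "indep_elements \<Omega> MX X MY Y"
  shows "distr \<Omega> (MX \<Otimes>\<^sub>M MY) (\<lambda>\<omega>. (X \<omega>, Y \<omega>)) = distr \<Omega> MX X \<Otimes>\<^sub>M distr \<Omega> MY Y"
proof -
  interpret prob_space \<Omega> by fact
  have X[measurable]: "X \<in> \<Omega> \<rightarrow>\<^sub>M MX" and Y[measurable]: "Y \<in> \<Omega> \<rightarrow>\<^sub>M MY"
    and I: "indep_set (sets (vimage_algebra (space \<Omega>) X MX)) (sets (vimage_algebra (space \<Omega>) Y MY))"
    using ind by (auto simp: indep_elements_def)
  interpret DX: prob_space "distr \<Omega> MX X" by (rule prob_space_distr) simp
  interpret DY: prob_space "distr \<Omega> MY Y" by (rule prob_space_distr) simp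
  show ?thesis
  proof (rule pair_measure_eqI[symmetric])
    fix A B assume "A \<in> sets (distr \<Omega> MX X)" "B \<in> sets (distr \<Omega> MY Y)"
    then have A[measurable]: "A \<in> sets MX" and B[measurable]: "B \<in> sets MY" by auto
    have "X -` A \<inter> space \<Omega> \<in> sets (vimage_algebra (space \<Omega>) X MX)"
      "Y -` B \<inter> space \<Omega> \<in> sets (vimage_algebra (space \<Omega>) Y MY)"
      by (auto intro: in_vimage_algebra)
    then have "prob ((X -` A \<inter> space \<Omega>) \<inter> (Y -` B \<inter> space \<Omega>)) =
        prob (X -` A \<inter> space \<Omega>) * prob (Y -` B \<inter> space \<Omega>)"
      by (rule indep_setD[OF I])
    moreover have "(X -` A \<inter> space \<Omega>) \<inter> (Y -` B \<inter> space \<Omega>) = (\<lambda>\<omega>. (X \<omega>, Y \<omega>)) -` (A \<times> B) \<inter> space \<Omega>"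
      by auto
    ultimately show "emeasure (distr \<Omega> MX X) A * emeasure (distr \<Omega> MY Y) B =
        emeasure (distr \<Omega> (MX \<Otimes>\<^sub>M MY) (\<lambda>\<omega>. (X \<omega>, Y \<omega>))) (A \<times> B)"
      by (simp add: emeasure_distr emeasure_eq_measure ennreal_mult)
  qed (auto intro: DX.sigma_finite_measure_axioms DY.sigma_finite_measure_axioms)
qed

text \<open>Freezing principle: \<open>T\<close> is integrated out with \<open>Z\<close> held fixed.
  Sets of the \<sigma>-algebra of \<open>Z\<close> are preimages under \<open>Z\<close>, so the
  defining identity of the conditional expectation becomes Fubini for the product law of
  \<open>(Z, T)\<close>.\<close>

lemma real_cond_exp_indicator_indep_elements:
  assumes "prob_space \<Omega>" and ind: "indep_elements \<Omega> MZ Z MT T"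
    and E[measurable]: "E \<in> sets (MZ \<Otimes>\<^sub>M MT)"
  shows "AE \<omega> in \<Omega>. real_cond_exp \<Omega> (vimage_algebra (space \<Omega>) Z MZ)
      (indicator {\<omega>\<in>space \<Omega>. (Z \<omega>, T \<omega>) \<in> E}) \<omega> = measure (distr \<Omega> MT T) (Pair (Z \<omega>) -` E)"
proof -
  interpret prob_space \<Omega> by fact
  have Z[measurable]: "Z \<in> \<Omega> \<rightarrow>\<^sub>M MZ" and T[measurable]: "T \<in> \<Omega> \<rightarrow>\<^sub>M MT"
    using ind by (auto simp: indep_elements_def)
  let ?F = "vimage_algebra (space \<Omega>) Z MZ"
  let ?PT = "distr \<Omega> MT T" and ?PZ = "distr \<Omega> MZ Z"
  interpret PT: prob_space ?PT by (rule prob_space_distr) simp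
  interpret PZ: prob_space ?PZ by (rule prob_space_distr) simp
  interpret F: finite_measure_subalgebra \<Omega> ?F
  proof
    have "Z \<in> space \<Omega> \<rightarrow> space MZ" using measurable_space[OF Z] by blast
    then show "subalgebra \<Omega> ?F"
      using measurable_sets[OF Z] by (auto simp: subalgebra_def sets_vimage_algebra2)
  qed
  have ZF[measurable]: "Z \<in> ?F \<rightarrow>\<^sub>M MZ"
    using measurable_space[OF Z] by (intro measurable_vimage_algebra1) blast
  have E'[measurable]: "E \<in> sets (MZ \<Otimes>\<^sub>M ?PT)" by simp
  have l[measurable]: "(\<lambda>z. measure ?PT (Pair z -` E)) \<in> borel_measurable MZ"
    using PT.measurable_emeasure_Pair[OF E'] unfolding measure_def by measurable
  show ?thesis
  proof (rule F.real_cond_exp_charact)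
    fix A assume "A \<in> sets ?F"
    then obtain A' where A'[measurable]: "A' \<in> sets MZ" and A: "A = Z -` A' \<inter> space \<Omega>"
      using measurable_space[OF Z] sets_vimage_algebra2[of Z "space \<Omega>" MZ] by blast
    have "(\<integral>\<omega>\<in>A. indicat_real {\<omega>\<in>space \<Omega>. (Z \<omega>, T \<omega>) \<in> E} \<omega> \<partial>\<Omega>) =
        measure \<Omega> {\<omega>\<in>space \<Omega>. Z \<omega> \<in> A' \<and> (Z \<omega>, T \<omega>) \<in> E}"
    proof -
      have "(\<integral>\<omega>\<in>A. indicat_real {\<omega>\<in>space \<Omega>. (Z \<omega>, T \<omega>) \<in> E} \<omega> \<partial>\<Omega>) =
          (\<integral>\<omega>. indicat_real {\<omega>\<in>space \<Omega>. Z \<omega> \<in> A' \<and> (Z \<omega>, T \<omega>) \<in> E} \<omega> \<partial>\<Omega>)"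
        unfolding set_lebesgue_integral_def
        by (intro Bochner_Integration.integral_cong) (auto simp: A indicator_def)
      then show ?thesis by simp
    qed
    also have "\<dots> = measure (distr \<Omega> (MZ \<Otimes>\<^sub>M MT) (\<lambda>\<omega>. (Z \<omega>, T \<omega>))) {p\<in>space (MZ \<Otimes>\<^sub>M MT). fst p \<in> A' \<and> p \<in> E}"
      using measurable_space[OF Z] measurable_space[OF T]
      by (subst measure_distr) (auto simp: space_pair_measure intro!: arg_cong[where f="measure \<Omega>"])
    also have "\<dots> = measure (?PZ \<Otimes>\<^sub>M ?PT) {p\<in>space (MZ \<Otimes>\<^sub>M MT). fst p \<in> A' \<and> p \<in> E}"
      by (simp add: distr_pair_indep_elements[OF assms(1) ind])
    also have "\<dots> = enn2real (\<integral>\<^sup>+ z. emeasure ?PT (Pair z -` {p\<in>space (MZ \<Otimes>\<^sub>M MT). fst p \<in> A' \<and> p \<in> E}) \<partial>?PZ)"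
      unfolding measure_def by (subst PT.emeasure_pair_measure_alt) auto
    also have "\<dots> = enn2real (\<integral>\<^sup>+ z. ennreal (indicator A' z * measure ?PT (Pair z -` E)) \<partial>?PZ)"
    proof -
      have "Pair z -` {p\<in>space (MZ \<Otimes>\<^sub>M MT). fst p \<in> A' \<and> p \<in> E} = (if z \<in> A' then Pair z -` E else {})" for z
        using sets.sets_into_space[OF E] by auto
      then show ?thesis
        by (intro arg_cong[where f=enn2real] nn_integral_cong)
           (auto simp: PT.emeasure_eq_measure indicator_def)
    qed
    also have "\<dots> = (\<integral> z. indicator A' z * measure ?PT (Pair z -` E) \<partial>?PZ)"
      by (intro integral_eq_nn_integral[symmetric]) auto
    also have "\<dots> = (\<integral> \<omega>. indicator A' (Z \<omega>) * measure ?PT (Pair (Z \<omega>) -` E) \<partial>\<Omega>)"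
      by (subst integral_distr) auto
    also have "\<dots> = (\<integral>\<omega>\<in>A. measure ?PT (Pair (Z \<omega>) -` E) \<partial>\<Omega>)"
      unfolding set_lebesgue_integral_def
      by (intro Bochner_Integration.integral_cong) (auto simp: A indicator_def)
    finally show "(\<integral>\<omega>\<in>A. indicat_real {\<omega>\<in>space \<Omega>. (Z \<omega>, T \<omega>) \<in> E} \<omega> \<partial>\<Omega>) =
      (\<integral>\<omega>\<in>A. measure ?PT (Pair (Z \<omega>) -` E) \<partial>\<Omega>)" .
  next
    show "integrable \<Omega> (indicator {\<omega>\<in>space \<Omega>. (Z \<omega>, T \<omega>) \<in> E} :: _ \<Rightarrow> real)"
      by (intro integrable_real_indicator) (auto simp: emeasure_eq_measure)
    show "integrable \<Omega> (\<lambda>\<omega>. measure ?PT (Pair (Z \<omega>) -` E))"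
      by (intro integrable_const_bound[where B=1]) (auto simp: PT.prob_le_1)
    show "(\<lambda>\<omega>. measure ?PT (Pair (Z \<omega>) -` E)) \<in> borel_measurable ?F"
      by measurable
  qed
qed

section \<open>The calibration bound\<close>

text \<open>Each observation and its uniform variable are merged into one point \<open>z i\<close>.
  These points are i.i.d., and the calibration argument meets the policies only through
  \<open>acc\<close> and \<open>X\<close>.\<close>

definition accepted_sample :: "nat \<Rightarrow> ('z \<Rightarrow> bool) \<Rightarrow> ('z \<Rightarrow> 'x) \<Rightarrow> (nat \<Rightarrow> 'z) \<Rightarrow> 'x list" where
  "accepted_sample n acc X z = map (\<lambda>i. X (z i)) (filter (\<lambda>i. acc (z i)) [0..<n])"

text \<open>The point \<open>x\<close> exceeds the threshold of the paper iff at least \<open>M - k\<close> of the \<open>M\<close> calibration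
  scores are smaller than its score. With \<open>c M = k + 1\<close> this is subtraction-free and covers the
  infinite threshold (\<open>k = -1\<close>) as well.\<close>

definition miscovers ::
  "('x list \<Rightarrow> 'x \<Rightarrow> real) \<Rightarrow> (nat \<Rightarrow> nat) \<Rightarrow> 'x list \<Rightarrow> nat set \<Rightarrow> 'x \<Rightarrow> bool" where
  "miscovers score c xs J x \<longleftrightarrow>
     (let train = nths xs (- J); calib = nths xs J
      in length calib
        < length (filter (\<lambda>y. score train y < score train x) calib) + c (length calib))"

text \<open>On index lists the roles of the coordinates depend only on \<open>l\<close> and
  \<open>J\<close>, and the data enter only through \<open>f\<close>. This allows freezing the
  training coordinates while the calibration ones stay random.\<close>

lemma miscovers_map:
  "miscovers score c (map f l) J x \<longleftrightarrow>
    length (nths l J)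
      < length (filter (\<lambda>i. score (map f (nths l (- J))) (f i) < score (map f (nths l (- J))) x) (nths l J))
        + c (length (nths l J))"
  by (simp add: miscovers_def nths_map filter_map o_def Let_def)

lemma accepted_sample_eq:
  assumes "\<And>i. i < n \<Longrightarrow> acc (z i) \<longleftrightarrow> i \<in> I"
  shows "accepted_sample n acc X z = map (\<lambda>i. X (z i)) (filter (\<lambda>i. i \<in> I) [0..<n])"
  using assms by (auto simp: accepted_sample_def intro!: arg_cong[where f="map _"] filter_cong)

text \<open>The assumption concerns the coordinates 0, ..., m - 1; relabelling along
  \<open>l\<close> carries it to any list of coordinates, random or frozen.\<close>

lemma measurable_score:
  fixes score :: "'x list \<Rightarrow> 'x \<Rightarrow> real"
  assumes score: "\<And>m. (\<lambda>(x, y). score (map x [0..<m]) y)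
      \<in> borel_measurable ((\<Pi>\<^sub>M i\<in>{..<m}. P) \<Otimes>\<^sub>M P)"
    and f: "\<And>i. i \<in> set l \<Longrightarrow> (\<lambda>\<omega>. f \<omega> i) \<in> N \<rightarrow>\<^sub>M P" and p[measurable]: "p \<in> N \<rightarrow>\<^sub>M P"
  shows "(\<lambda>\<omega>. score (map (f \<omega>) l) (p \<omega>)) \<in> borel_measurable N"
proof -
  have [measurable]: "(\<lambda>\<omega>. f \<omega> (l ! j)) \<in> N \<rightarrow>\<^sub>M P" if "j < length l" for j
    using f that by simp
  have "(\<lambda>\<omega>. (\<lambda>j\<in>{..<length l}. f \<omega> (l ! j), p \<omega>)) \<in> N \<rightarrow>\<^sub>M (\<Pi>\<^sub>M i\<in>{..<length l}. P) \<Otimes>\<^sub>M P"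
    by measurable
  from measurable_compose[OF this score[of "length l"]]
  have "(\<lambda>\<omega>. score (map (\<lambda>j\<in>{..<length l}. f \<omega> (l ! j)) [0..<length l]) (p \<omega>)) \<in> borel_measurable N"
    by simp
  moreover have "map (\<lambda>j\<in>{..<length l}. f \<omega> (l ! j)) [0..<length l] = map (f \<omega>) l" for \<omega>
    by (rule nth_equalityI) auto
  ultimately show ?thesis by simp
qed

text \<open>Both the length of the sample and the calibration positions are random. They take
  finitely many joint values, an acceptance pattern \<open>I\<close> and a position set
  \<open>S\<close>; with these fixed, the event compares finite sums of measurable terms.
  \<open>J\<close> may depend on the sample point, so that frozen and random splits are treated
  alike.\<close>

lemma pred_miscovers:
  fixes score :: "'x list \<Rightarrow> 'x \<Rightarrow> real"
  assumes score: "\<And>m. (\<lambda>(x, y). score (map x [0..<m]) y)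
      \<in> borel_measurable ((\<Pi>\<^sub>M i\<in>{..<m}. P) \<Otimes>\<^sub>M P)"
    and z: "\<And>i. i < n \<Longrightarrow> (\<lambda>\<omega>. z \<omega> i) \<in> N \<rightarrow>\<^sub>M Q"
    and acc[measurable]: "Measurable.pred Q acc" and X[measurable]: "X \<in> Q \<rightarrow>\<^sub>M P"
    and J: "\<And>m. J m \<in> N \<rightarrow>\<^sub>M count_space (\<J> m)" "\<And>m. finite (\<J> m)"
    and p[measurable]: "p \<in> N \<rightarrow>\<^sub>M P"
  shows "Measurable.pred N (\<lambda>\<omega>. miscovers score c (accepted_sample n acc X (z \<omega>))
    (J (length (accepted_sample n acc X (z \<omega>))) \<omega>) (p \<omega>))"
proof -
  define l where "l I = filter (\<lambda>i. i \<in> I) [0..<n]" for I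
  define miss where "miss I S \<omega> \<longleftrightarrow> miscovers score c (map (\<lambda>i. X (z \<omega> i)) (l I)) S (p \<omega>)" for I S \<omega>
  have z'[measurable]: "(\<lambda>\<omega>. X (z \<omega> i)) \<in> N \<rightarrow>\<^sub>M P" "Measurable.pred N (\<lambda>\<omega>. acc (z \<omega> i))"
    if "i < n" for i
    using z[OF that] by measurable
  have [measurable]: "Measurable.pred N (miss I S)" for I S
  proof -
    let ?t = "nths (l I) (- S)" and ?k = "nths (l I) S"
    have sub: "i < n" if "i \<in> set (nths (l I) A)" for i A
      using that set_nths_subset[of "l I" A] by (auto simp: l_def)
    have s1[measurable]: "(\<lambda>\<omega>. score (map (\<lambda>i. X (z \<omega> i)) ?t) (p \<omega>)) \<in> borel_measurable N"
      by (intro measurable_score[OF score] z'(1) p) (rule sub)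
    have s2[measurable]: "(\<lambda>\<omega>. score (map (\<lambda>i. X (z \<omega> i)) ?t) (X (z \<omega> i))) \<in> borel_measurable N"
      if "i \<in> set ?k" for i
      by (intro measurable_score[OF score] z'(1) sub[OF that]) (rule sub)
    have "distinct ?k" by (simp add: l_def)
    then have len: "length (filter q ?k) = (\<Sum>i\<in>set ?k. if q i then 1 else 0)" for q
      by (simp add: distinct_length_filter sum.If_cases Int_commute)
    have "Measurable.pred N (\<lambda>\<omega>. length ?k < (\<Sum>i\<in>set ?k.
        if score (map (\<lambda>i. X (z \<omega> i)) ?t) (X (z \<omega> i)) < score (map (\<lambda>i. X (z \<omega> i)) ?t) (p \<omega>)
        then 1 else 0) + c (length ?k))"
      by measurable
    then show ?thesis unfolding miss_def miscovers_map len .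
  qed
  have [measurable]: "Measurable.pred N (\<lambda>\<omega>. J m \<omega> = S)" if "S \<in> \<J> m" for m S
    using measurable_sets[OF J(1), of "{S}" m] that
    by (simp add: pred_def vimage_def Int_def conj_commute)
  have [simp]: "finite (\<J> m)" for m by (rule J)
  have "Measurable.pred N (\<lambda>\<omega>. \<exists>I\<in>Pow {..<n}. (\<forall>i\<in>{..<n}. acc (z \<omega> i) \<longleftrightarrow> i \<in> I) \<and>
      (\<exists>S\<in>\<J> (length (l I)). J (length (l I)) \<omega> = S \<and> miss I S \<omega>))"
    by measurable
  also have "?this \<longleftrightarrow> ?thesis"
  proof (rule measurable_cong)
    fix \<omega> assume \<omega>: "\<omega> \<in> space N"
    define I where "I = {i\<in>{..<n}. acc (z \<omega> i)}"
    have 1: "accepted_sample n acc X (z \<omega>) = map (\<lambda>i. X (z \<omega> i)) (l I)"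
      unfolding l_def by (rule accepted_sample_eq) (auto simp: I_def)
    have 2: "I' \<in> Pow {..<n} \<and> (\<forall>i\<in>{..<n}. acc (z \<omega> i) \<longleftrightarrow> i \<in> I') \<longleftrightarrow> I' = I" for I'
      by (auto simp: I_def)
    have "(\<exists>I\<in>Pow {..<n}. (\<forall>i\<in>{..<n}. acc (z \<omega> i) \<longleftrightarrow> i \<in> I) \<and>
        (\<exists>S\<in>\<J> (length (l I)). J (length (l I)) \<omega> = S \<and> miss I S \<omega>)) \<longleftrightarrow>
        (\<exists>S\<in>\<J> (length (l I)). J (length (l I)) \<omega> = S \<and> miss I S \<omega>)"
      using 2 by metis
    also have "\<dots> \<longleftrightarrow> miss I (J (length (l I)) \<omega>) \<omega>"
      using measurable_space[OF J(1) \<omega>] by auto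
    finally show "(\<exists>I\<in>Pow {..<n}. (\<forall>i\<in>{..<n}. acc (z \<omega> i) \<longleftrightarrow> i \<in> I) \<and>
        (\<exists>S\<in>\<J> (length (l I)). J (length (l I)) \<omega> = S \<and> miss I S \<omega>)) \<longleftrightarrow>
      miscovers score c (accepted_sample n acc X (z \<omega>))
        (J (length (accepted_sample n acc X (z \<omega>))) \<omega>) (p \<omega>)"
      by (simp add: 1 miss_def)
  qed
  finally show ?thesis .
qed

text \<open>A measurable superset of the exceptional event is produced, so that the measurability of
  the event itself need not be shown.\<close>

lemma calibration_bound:
  fixes kl :: "'i list" and \<sigma> :: "'x \<Rightarrow> real"
  assumes Q: "prob_space Q" and P: "prob_space P"
    and acc[measurable]: "Measurable.pred Q acc" and X[measurable]: "X \<in> Q \<rightarrow>\<^sub>M P"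
    and accept: "\<And>E. E \<in> sets P \<Longrightarrow> measure Q {z\<in>space Q. acc z \<and> X z \<in> E} = q * measure P E"
    and \<sigma>[measurable]: "\<sigma> \<in> borel_measurable P" and \<epsilon>: "0 < \<epsilon>" "\<epsilon> < 1" and "distinct kl"
    and c: "measure_pmf.prob (binomial_pmf (length kl) \<epsilon>) {..<c} \<le> \<delta>"
  obtains S where "S \<in> sets (PiM (set kl) (\<lambda>_. Q))" "measure (PiM (set kl) (\<lambda>_. Q)) S \<le> \<delta> * q ^ length kl"
    "\<And>z. z \<in> space (PiM (set kl) (\<lambda>_. Q)) \<Longrightarrow> (\<And>i. i \<in> set kl \<Longrightarrow> acc (z i)) \<Longrightarrow>
      \<epsilon> < measure P {x\<in>space P. length kl < length (filter (\<lambda>i. \<sigma> (X (z i)) < \<sigma> x) kl) + c} \<Longrightarrow> z \<in> S"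
proof -
  interpret P: prob_space P by fact
  interpret Q: prob_space Q by fact
  define K where "K = set kl"
  have cK: "card K = length kl" and [simp]: "finite K"
    using \<open>distinct kl\<close> by (simp_all add: K_def distinct_card)
  obtain t where t: "measure P {x\<in>space P. t < \<sigma> x} \<le> \<epsilon>" "\<epsilon> \<le> measure P {x\<in>space P. t \<le> \<sigma> x}"
    using exists_quantile[OF P \<sigma> \<epsilon>] by blast
  define G where "G = {z\<in>space Q. acc z}"
  \<comment> \<open>A success is an accepted point whose score reaches \<open>t\<close>. The weak
    inequality makes its probability at least \<epsilon> times that of \<open>G\<close>; acceptance
    contributes the same factor \<open>q\<close> to both.\<close>
  define H where "H = {z\<in>space Q. acc z \<and> t \<le> \<sigma> (X z)}"
  have [measurable]: "G \<in> sets Q" "H \<in> sets Q" and "H \<subseteq> G" unfolding G_def H_def by auto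
  have "{z\<in>space Q. acc z \<and> X z \<in> space P} = G"
    using measurable_space[OF X] by (auto simp: G_def)
  then have G: "measure Q G = q" using accept[of "space P"] by (simp add: P.prob_space)
  then have "0 \<le> q" using measure_nonneg[of Q G] by simp
  have "{z\<in>space Q. acc z \<and> X z \<in> {x\<in>space P. t \<le> \<sigma> x}} = H"
    using measurable_space[OF X] by (auto simp: H_def)
  then have H: "measure Q H = q * measure P {x\<in>space P. t \<le> \<sigma> x}"
    using accept[of "{x\<in>space P. t \<le> \<sigma> x}"] by simp
  define S where "S = {z\<in>space (PiM K (\<lambda>_. Q)). (\<forall>i\<in>K. z i \<in> G) \<and> card {i\<in>K. z i \<in> H} < c}"
  have "S = {z\<in>space (PiM K (\<lambda>_. Q)). (\<forall>i\<in>K. z i \<in> G) \<and> (\<Sum>i\<in>K. indicator H (z i)::nat) < c}"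
    by (simp add: S_def count_sum_indicator)
  also have "\<dots> \<in> sets (PiM K (\<lambda>_. Q))" by measurable
  finally have S: "S \<in> sets (PiM K (\<lambda>_. Q))" .
  have "measure (PiM K (\<lambda>_. Q)) S \<le> q ^ card K * measure_pmf.prob (binomial_pmf (card K) \<epsilon>) {..<c}"
    unfolding S_def G[symmetric]
    using t \<epsilon> \<open>0 \<le> q\<close> \<open>H \<subseteq> G\<close>
    by (intro prob_PiM_count_less_le_binomial Q) (auto simp: G H mult.commute[of \<epsilon>] mult_left_mono)
  also have "\<dots> \<le> q ^ card K * \<delta>"
    using c \<open>0 \<le> q\<close> by (intro mult_left_mono) (auto simp: cK)
  finally have mS: "measure (PiM K (\<lambda>_. Q)) S \<le> \<delta> * q ^ length kl" by (simp add: cK mult.commute)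
  have "z \<in> S" if z: "z \<in> space (PiM K (\<lambda>_. Q))" "\<And>i. i \<in> K \<Longrightarrow> acc (z i)"
    and less: "\<epsilon> < measure P {x\<in>space P. length kl < length (filter (\<lambda>i. \<sigma> (X (z i)) < \<sigma> x) kl) + c}" for z
  proof -
    have zQ: "z i \<in> space Q" if "i \<in> K" for i using z that by (auto simp: space_PiM PiE_iff)
    have "card {i\<in>K. z i \<in> H} < c"
    proof (rule ccontr)
      assume "\<not> card {i\<in>K. z i \<in> H} < c"
      then have ge: "c \<le> card {i\<in>K. z i \<in> H}" by simp
      \<comment> \<open>A point of \<open>H\<close> has score at least \<open>t\<close>, so it is
        not below \<open>\<sigma> x\<close>. With \<open>c\<close> or more such points at most
        \<open>length kl - c\<close> scores remain below, too few for miscoverage.\<close>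
      have "\<not> length kl < length (filter (\<lambda>i. \<sigma> (X (z i)) < \<sigma> x) kl) + c" if "\<sigma> x \<le> t" for x
      proof -
        have "length (filter (\<lambda>i. \<sigma> (X (z i)) < \<sigma> x) kl) = card {i\<in>K. \<sigma> (X (z i)) < \<sigma> x}"
          using \<open>distinct kl\<close> by (simp add: distinct_length_filter K_def Int_def conj_commute)
        also have "\<dots> \<le> card (K - {i\<in>K. z i \<in> H})"
          using that by (intro card_mono) (auto simp: H_def)
        also have "\<dots> = card K - card {i\<in>K. z i \<in> H}" by (intro card_Diff_subset) auto
        finally show ?thesis
          using ge card_mono[of K "{i\<in>K. z i \<in> H}"] by (simp add: cK)
      qed
      then have "{x\<in>space P. length kl < length (filter (\<lambda>i. \<sigma> (X (z i)) < \<sigma> x) kl) + c}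
          \<subseteq> {x\<in>space P. t < \<sigma> x}"
        using not_le by blast
      then have "measure P {x\<in>space P. length kl < length (filter (\<lambda>i. \<sigma> (X (z i)) < \<sigma> x) kl) + c} \<le> \<epsilon>"
        by (rule order.trans[OF P.finite_measure_mono t(1)]) simp
      then show False using less by simp
    qed
    then show ?thesis using z zQ by (auto simp: S_def G_def)
  qed
  then show ?thesis using that S mS unfolding K_def by blast
qed

lemma set_nths_disjoint:
  assumes "distinct l"
  shows "set (nths l (- J)) \<inter> set (nths l J) = {}"
  using assms by (auto simp: set_nths nth_eq_iff_index_eq)

text \<open>The split is deterministic here; a random seed is integrated out afterwards. The
  hypothesis \<open>accept\<close> says, without dividing, that an accepted point has law
  \<open>P\<close>. The bound is proved on each acceptance pattern and then summed.\<close>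

lemma prob_miscoverage_gt_le:
  fixes score :: "'x list \<Rightarrow> 'x \<Rightarrow> real"
  assumes Q: "prob_space Q" and P: "prob_space P"
    and score: "\<And>m. (\<lambda>(x, y). score (map x [0..<m]) y)
      \<in> borel_measurable ((\<Pi>\<^sub>M i\<in>{..<m}. P) \<Otimes>\<^sub>M P)"
    and acc[measurable]: "Measurable.pred Q acc" and X[measurable]: "X \<in> Q \<rightarrow>\<^sub>M P"
    and accept: "\<And>E. E \<in> sets P \<Longrightarrow> measure Q {z\<in>space Q. acc z \<and> X z \<in> E} = q * measure P E"
    and \<epsilon>: "0 < \<epsilon>" "\<epsilon> < 1"
    and c: "\<And>M. measure_pmf.prob (binomial_pmf M \<epsilon>) {..<c M} \<le> \<delta>"
  shows "{z\<in>space (PiM {..<n} (\<lambda>_. Q)). \<epsilon> < measure P {x\<in>space P.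
      miscovers score c (accepted_sample n acc X z) (J (length (accepted_sample n acc X z))) x}}
      \<in> sets (PiM {..<n} (\<lambda>_. Q))" (is "?bad \<in> _")
    and "measure (PiM {..<n} (\<lambda>_. Q)) {z\<in>space (PiM {..<n} (\<lambda>_. Q)). \<epsilon> < measure P {x\<in>space P.
      miscovers score c (accepted_sample n acc X z) (J (length (accepted_sample n acc X z))) x}} \<le> \<delta>"
proof -
  interpret P: prob_space P by fact
  interpret Q: prob_space Q by fact
  interpret PS: product_prob_space "\<lambda>_::nat. Q" UNIV by unfold_locales
  let ?N = "PiM {..<n} (\<lambda>_. Q)"
  interpret N: prob_space ?N by (intro prob_space_PiM Q)
  define xs where "xs = accepted_sample n acc X"
  have "Measurable.pred (?N \<Otimes>\<^sub>M P) (\<lambda>\<omega>. miscovers score c (accepted_sample n acc X (fst \<omega>))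
      ((\<lambda>m _. J m) (length (accepted_sample n acc X (fst \<omega>))) \<omega>) (snd \<omega>))"
    by (rule pred_miscovers[OF score, where \<J>="\<lambda>m. {J m}" and Q=Q]) auto
  then have E: "{\<omega>\<in>space (?N \<Otimes>\<^sub>M P). miscovers score c (xs (fst \<omega>)) (J (length (xs (fst \<omega>)))) (snd \<omega>)}
      \<in> sets (?N \<Otimes>\<^sub>M P)" (is "?E \<in> _")
    by (simp add: xs_def pred_def)
  have "(\<lambda>z. measure P (Pair z -` ?E)) \<in> borel_measurable ?N"
    using P.measurable_emeasure_Pair[OF E] unfolding measure_def by measurable
  then have "{z\<in>space ?N. \<epsilon> < measure P (Pair z -` ?E)} \<in> sets ?N" by measurable
  also have "{z\<in>space ?N. \<epsilon> < measure P (Pair z -` ?E)} = ?bad"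
  proof -
    have "Pair z -` ?E = {x\<in>space P. miscovers score c (xs z) (J (length (xs z))) x}" if "z \<in> space ?N" for z
      using that by (auto simp: space_pair_measure)
    then show ?thesis by (auto simp: xs_def)
  qed
  finally show bad[measurable]: "?bad \<in> sets ?N" .

  have "0 \<le> \<delta>" using c[of 0] order.trans measure_nonneg by blast
  have q: "q = measure Q {z\<in>space Q. acc z}"
  proof -
    have "{z\<in>space Q. acc z \<and> X z \<in> space P} = {z\<in>space Q. acc z}"
      using measurable_space[OF X] by auto
    then show ?thesis using accept[of "space P"] by (simp add: P.prob_space)
  qed
  then have "0 \<le> q" by simp
  define A where "A I = {z\<in>space ?N. \<forall>i\<in>{..<n}. acc (z i) \<longleftrightarrow> i \<in> I}" for I
  have A[measurable]: "A I \<in> sets ?N" for I unfolding A_def by measurable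
  \<comment> \<open>On a fixed acceptance pattern the training and calibration positions are fixed; Fubini then
    reduces the claim to the calibration coordinates, the others being frozen.\<close>
  have part: "measure ?N (?bad \<inter> A I) \<le> \<delta> * measure ?N (A I)" if "I \<subseteq> {..<n}" for I
  proof -
    define l where "l = filter (\<lambda>i. i \<in> I) [0..<n]"
    define kl where "kl = nths l (J (length l))"
    define tl where "tl = nths l (- J (length l))"
    define K where "K = set kl"
    define R where "R = {..<n} - K"
    have dl: "distinct l" and sl: "set l = I" using that by (auto simp: l_def)
    then have dk: "distinct kl" and KI: "K \<subseteq> I" and tI: "set tl \<subseteq> I" and tk: "set tl \<inter> K = {}"
      using set_nths_subset[of l] set_nths_disjoint[OF dl]
      by (auto simp: kl_def tl_def K_def simp del: disjoint_iff)
    then have KR: "R \<union> K = {..<n}" "R \<inter> K = {}" "finite R" "finite K" "set tl \<subseteq> R"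
      and cK: "card K = length kl"
      using that by (auto simp: R_def K_def distinct_card)
    let ?R = "PiM R (\<lambda>_. Q)" and ?K = "PiM K (\<lambda>_. Q)"
    interpret K: prob_space ?K by (intro prob_space_PiM Q)
    define AR where "AR = {y\<in>space ?R. \<forall>i\<in>R. acc (y i) \<longleftrightarrow> i \<in> I}"
    have AR[measurable]: "AR \<in> sets ?R" unfolding AR_def using KR(3) by measurable
    \<comment> \<open>All calibration positions are accepted ones, so in the split coordinates the
      pattern is a rectangle: a condition on \<open>y\<close> times acceptance of every coordinate
      in \<open>K\<close>.\<close>
    have mem_A: "merge R K (y, x) \<in> A I \<longleftrightarrow> y \<in> AR \<and> (\<forall>i\<in>K. acc (x i))"
      if "y \<in> space ?R" "x \<in> space ?K" for x y
    proof -
      have "merge R K (y, x) \<in> space ?N"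
        using that KR(1) by (simp add: space_PiM merge_def PiE_def extensional_def) (auto simp: Pi_iff)
      then show ?thesis
        using that KR(2) KI unfolding A_def AR_def KR(1)[symmetric] by (auto simp: merge_def)
    qed
    have fold: "emeasure ?N B = (\<integral>\<^sup>+ y. \<integral>\<^sup>+ x. indicator B (merge R K (y, x)) \<partial>?K \<partial>?R)"
      if "B \<in> sets ?N" for B
      using PS.product_nn_integral_fold[OF KR(2-4), of "indicator B"] that
      by (simp add: KR(1))
    have "emeasure ?N (A I) = (\<integral>\<^sup>+ y. \<integral>\<^sup>+ x. indicator AR y * indicator (Pi\<^sub>E K (\<lambda>_. {z\<in>space Q. acc z})) x \<partial>?K \<partial>?R)"
      unfolding fold[OF A]
      by (intro nn_integral_cong) (auto simp: mem_A space_PiM indicator_def PiE_iff)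
    also have "\<dots> = (\<integral>\<^sup>+ y. indicator AR y * ennreal (q ^ length kl) \<partial>?R)"
      using KR(4) by (simp add: nn_integral_cmult PS.emeasure_PiM Q.emeasure_eq_measure q[symmetric]
          ennreal_power \<open>0 \<le> q\<close> cK)
    finally have eA: "emeasure ?N (A I) = (\<integral>\<^sup>+ y. indicator AR y * ennreal (q ^ length kl) \<partial>?R)" .
    \<comment> \<open>The factor \<open>q ^ length kl\<close> is the one that \<open>eA\<close>
      gives to the whole pattern, so integration over \<open>y\<close> produces \<delta> times its
      measure.\<close>
    have inner: "(\<integral>\<^sup>+ x. indicator (?bad \<inter> A I) (merge R K (y, x)) \<partial>?K) \<le>
        indicator AR y * ennreal (q ^ length kl) * ennreal \<delta>" if y: "y \<in> space ?R" for y
    proof -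
      \<comment> \<open>Training positions lie in \<open>R\<close>, so for frozen \<open>y\<close>
        the score is a fixed function; its quantile, and the set \<open>S\<close> below, may vary
        with \<open>y\<close>.\<close>
      define \<sigma> where "\<sigma> = score (map (\<lambda>i. X (y i)) tl)"
      have \<sigma>: "\<sigma> \<in> borel_measurable P"
      proof -
        have "X (y i) \<in> space P" if "i \<in> set tl" for i
          using that y KR(5) measurable_space[OF X] by (auto simp: space_PiM PiE_iff)
        then show ?thesis
          unfolding \<sigma>_def by (intro measurable_score[OF score]) auto
      qed
      obtain S where S: "S \<in> sets ?K" "measure ?K S \<le> \<delta> * q ^ length kl"
        "\<And>z. z \<in> space ?K \<Longrightarrow> (\<And>i. i \<in> K \<Longrightarrow> acc (z i)) \<Longrightarrow>
          \<epsilon> < measure P {x\<in>space P. length kl < length (filter (\<lambda>i. \<sigma> (X (z i)) < \<sigma> x) kl) + c (length kl)}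
          \<Longrightarrow> z \<in> S"
        using calibration_bound[OF Q P acc X accept \<sigma> \<epsilon> dk c] unfolding K_def by blast
      have "indicator (?bad \<inter> A I) (merge R K (y, x)) \<le> (indicator AR y * indicator S x :: ennreal)"
        if x: "x \<in> space ?K" for x
      proof (cases "merge R K (y, x) \<in> ?bad \<inter> A I")
        case True
        let ?m = "merge R K (y, x)"
        have yx: "y \<in> AR" "\<forall>i\<in>K. acc (x i)" using True mem_A[OF y x] by auto
        have "xs ?m = map (\<lambda>i. X (?m i)) l"
          unfolding xs_def l_def by (rule accepted_sample_eq) (use True in \<open>auto simp: A_def\<close>)
        moreover have "\<epsilon> < measure P {p\<in>space P. miscovers score c (xs ?m) (J (length (xs ?m))) p}"
          using True by (auto simp: xs_def)
        ultimately have "\<epsilon> < measure P {p\<in>space P. length kl <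
            length (filter (\<lambda>i. score (map (\<lambda>i. X (?m i)) tl) (X (?m i)) < score (map (\<lambda>i. X (?m i)) tl) p) kl)
            + c (length kl)}"
          by (simp add: miscovers_map kl_def tl_def)
        moreover have "map (\<lambda>i. X (?m i)) tl = map (\<lambda>i. X (y i)) tl"
          using KR(5) by (auto simp: merge_def)
        moreover have "filter (\<lambda>i. \<sigma> (X (?m i)) < \<sigma> p) kl = filter (\<lambda>i. \<sigma> (X (x i)) < \<sigma> p) kl" for p
          using KR(2) by (intro filter_cong) (auto simp: merge_def K_def)
        ultimately have "x \<in> S" using yx(2) x by (intro S(3)) (auto simp: \<sigma>_def)
        then show ?thesis using yx(1) by (simp add: indicator_def)
      qed simp
      then have "(\<integral>\<^sup>+ x. indicator (?bad \<inter> A I) (merge R K (y, x)) \<partial>?K) \<le>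
          (\<integral>\<^sup>+ x. indicator AR y * indicator S x \<partial>?K)"
        by (rule nn_integral_mono)
      also have "\<dots> = indicator AR y * emeasure ?K S"
        using S(1) by (simp add: nn_integral_cmult)
      also have "\<dots> \<le> indicator AR y * ennreal (q ^ length kl * \<delta>)"
        using S(2) by (intro mult_left_mono) (auto simp: K.emeasure_eq_measure mult.commute intro!: ennreal_leI)
      finally show ?thesis
        using \<open>0 \<le> q\<close> \<open>0 \<le> \<delta>\<close> by (simp add: ennreal_mult mult.assoc)
    qed
    have "emeasure ?N (?bad \<inter> A I) \<le> (\<integral>\<^sup>+ y. indicator AR y * ennreal (q ^ length kl) * ennreal \<delta> \<partial>?R)"
      unfolding fold[OF sets.Int[OF bad A]] by (intro nn_integral_mono inner)
    also have "\<dots> = emeasure ?N (A I) * ennreal \<delta>"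
      unfolding eA by (rule nn_integral_multc) measurable
    finally show ?thesis
      using \<open>0 \<le> \<delta>\<close> by (simp add: N.emeasure_eq_measure mult.commute flip: ennreal_mult)
  qed
  have "(\<Union>I\<in>Pow {..<n}. A I) = space ?N"
  proof
    show "space ?N \<subseteq> (\<Union>I\<in>Pow {..<n}. A I)"
    proof
      fix z assume "z \<in> space ?N"
      then have "z \<in> A {i\<in>{..<n}. acc (z i)}" by (simp add: A_def)
      then show "z \<in> (\<Union>I\<in>Pow {..<n}. A I)" by (rule UN_I[rotated]) auto
    qed
  qed (auto simp: A_def)
  then have "measure ?N ?bad = measure ?N (\<Union>I\<in>Pow {..<n}. ?bad \<inter> A I)"
    by (simp only: Int_UN_distrib[symmetric] sets.Int_space_eq2[OF bad])
  also have "\<dots> \<le> (\<Sum>I\<in>Pow {..<n}. measure ?N (?bad \<inter> A I))"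
    by (intro N.finite_measure_subadditive_finite) auto
  also have "\<dots> \<le> (\<Sum>I\<in>Pow {..<n}. \<delta> * measure ?N (A I))"
    by (intro sum_mono part) auto
  also have "\<dots> = \<delta> * measure ?N (\<Union>I\<in>Pow {..<n}. A I)"
  proof -
    have "disjoint_family_on A (Pow {..<n})"
      by (auto simp: disjoint_family_on_def A_def set_eq_iff)
    then show ?thesis
      by (subst N.finite_measure_finite_Union) (auto simp: sum_distrib_left)
  qed
  also have "\<dots> \<le> \<delta>"
    using \<open>0 \<le> \<delta>\<close> N.prob_le_1 by (intro mult_left_le) auto
  finally show "measure ?N ?bad \<le> \<delta>" .
qed

section \<open>Acceptance probabilities\<close>

text \<open>Integrating \<open>pe \<le> b * pb\<close> over the actions compares two total masses
  equal to 1, so every admissible \<open>b\<close> is at least 1 and the infimum is real. It is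
  itself admissible: divide where \<open>pb\<close> is positive; where \<open>pb\<close> vanishes,
  any admissible \<open>b\<close> forces \<open>pe\<close> to vanish.\<close>

lemma weight_bound_real:
  assumes behavior: "policy_with_density CS AS \<pi>b pb" and target: "policy_with_density CS AS \<pi>e pe"
    and "space CS \<noteq> {}" and "weight_bound CS AS pe pb < \<infinity>"
  shows "1 \<le> real_of_ereal (weight_bound CS AS pe pb)"
    "\<And>s a. s \<in> space CS \<Longrightarrow> a \<in> space AS \<Longrightarrow>
      pe s a \<le> real_of_ereal (weight_bound CS AS pe pb) * pb s a"
proof -
  define A where "A = {b. \<forall>s\<in>space CS. \<forall>a\<in>space AS. pe s a \<le> b * pb s a}"
  have "A \<noteq> {}"
    using assms(4) by (auto simp: weight_bound_def A_def[symmetric] top_ereal_def)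
  have nonneg: "0 \<le> pe s a" "0 \<le> pb s a" if "s \<in> space CS" "a \<in> space AS" for s a
    using behavior target that by (auto simp: policy_with_density_def)
  have ge1: "1 \<le> b" if "b \<in> A" for b
  proof -
    obtain s where s: "s \<in> space CS" using \<open>space CS \<noteq> {}\<close> by auto
    have mb[measurable]: "pb s \<in> borel_measurable AS" and me[measurable]: "pe s \<in> borel_measurable AS"
      using behavior target s by (auto simp: policy_with_density_def dest: measurable_Pair2)
    have "prob_space (\<pi>b s)" "prob_space (\<pi>e s)"
      and d: "\<pi>b s = density AS (\<lambda>a. ennreal (pb s a))" "\<pi>e s = density AS (\<lambda>a. ennreal (pe s a))"
      using behavior target s
      by (auto simp: policy_with_density_def space_prob_algebra dest!: measurable_space)
    then have "emeasure (\<pi>b s) (space AS) = 1" "emeasure (\<pi>e s) (space AS) = 1"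
      by (metis prob_space.emeasure_space_1 space_density)+
    then have 1: "(\<integral>\<^sup>+a. ennreal (pb s a) \<partial>AS) = 1" "(\<integral>\<^sup>+a. ennreal (pe s a) \<partial>AS) = 1"
      by (auto simp: d emeasure_density cong: nn_integral_cong)
    have "(\<integral>\<^sup>+a. ennreal (pe s a) \<partial>AS) \<le> (\<integral>\<^sup>+a. ennreal b * ennreal (pb s a) \<partial>AS)"
      using that s nonneg by (intro nn_integral_mono) (auto simp: A_def intro!: ennreal_leI simp flip: ennreal_mult'')
    then have "1 \<le> ennreal b" by (simp add: nn_integral_cmult 1)
    then show ?thesis by simp
  qed
  then have bdd: "bdd_below A" by (rule bdd_belowI)
  have w: "weight_bound CS AS pe pb = ereal (Inf A)"
    unfolding weight_bound_def A_def[symmetric] by (rule ereal_Inf'[symmetric]) fact+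
  show "1 \<le> real_of_ereal (weight_bound CS AS pe pb)"
    using ge1 \<open>A \<noteq> {}\<close> by (auto simp: w intro: cInf_greatest)
  fix s a assume sa: "s \<in> space CS" "a \<in> space AS"
  show "pe s a \<le> real_of_ereal (weight_bound CS AS pe pb) * pb s a"
  proof (cases "pb s a = 0")
    case True
    then show ?thesis using \<open>A \<noteq> {}\<close> sa unfolding A_def by fastforce
  next
    case False
    then have "0 < pb s a" using nonneg[OF sa] by simp
    moreover have "pe s a / pb s a \<le> Inf A"
      using sa \<open>0 < pb s a\<close> \<open>A \<noteq> {}\<close> by (intro cInf_greatest) (auto simp: A_def pos_divide_le_eq)
    ultimately show ?thesis by (simp add: w pos_divide_le_eq)
  qed
qed

context
  fixes CS :: "'s measure" and AS :: "'a measure" and PS :: "'s measure"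
    and PR :: "'s \<times> 'a \<Rightarrow> real measure"
  assumes PS: "PS \<in> space (prob_algebra CS)"
    and PR: "PR \<in> CS \<Otimes>\<^sub>M AS \<rightarrow>\<^sub>M prob_algebra borel"
begin

lemma obs_law_kernels:
  assumes \<pi>: "\<pi> \<in> CS \<rightarrow>\<^sub>M prob_algebra AS"
  shows "(\<lambda>(s, a). PR (s, a) \<bind> (\<lambda>r. return (obs_space CS AS) (s, a, r)))
      \<in> CS \<Otimes>\<^sub>M AS \<rightarrow>\<^sub>M prob_algebra (obs_space CS AS)"
    and "(\<lambda>s. \<pi> s \<bind> (\<lambda>a. PR (s, a) \<bind> (\<lambda>r. return (obs_space CS AS) (s, a, r))))
      \<in> CS \<rightarrow>\<^sub>M prob_algebra (obs_space CS AS)"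
    and "obs_law CS AS PS PR \<pi> \<in> space (prob_algebra (obs_space CS AS))"
proof -
  show 1: "(\<lambda>(s, a). PR (s, a) \<bind> (\<lambda>r. return (obs_space CS AS) (s, a, r)))
      \<in> CS \<Otimes>\<^sub>M AS \<rightarrow>\<^sub>M prob_algebra (obs_space CS AS)"
    unfolding case_prod_beta
    by (rule measurable_bind_prob_space2[where N=borel]) (use PR in measurable)
  show 2: "(\<lambda>s. \<pi> s \<bind> (\<lambda>a. PR (s, a) \<bind> (\<lambda>r. return (obs_space CS AS) (s, a, r))))
      \<in> CS \<rightarrow>\<^sub>M prob_algebra (obs_space CS AS)"
    by (rule measurable_bind_prob_space2[OF \<pi> 1])
  show "obs_law CS AS PS PR \<pi> \<in> space (prob_algebra (obs_space CS AS))"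
    using measurable_space[OF measurable_bind_prob_space[OF measurable_const[OF PS] 2, of "count_space UNIV"]]
    by (simp add: obs_law_def)
qed

text \<open>Unrolling the three kernels lets the change of policy take place in the action integral
  alone, with the context fixed.\<close>

lemma nn_integral_obs_law:
  assumes \<pi>: "\<pi> \<in> CS \<rightarrow>\<^sub>M prob_algebra AS" and f[measurable]: "f \<in> borel_measurable (obs_space CS AS)"
  shows "(\<integral>\<^sup>+x. f x \<partial>obs_law CS AS PS PR \<pi>) = (\<integral>\<^sup>+s. \<integral>\<^sup>+a. \<integral>\<^sup>+r. f (s, a, r) \<partial>PR (s, a) \<partial>\<pi> s \<partial>PS)"
proof -
  have sPS: "sets PS = sets CS" "space PS = space CS"
    using PS by (auto simp: space_prob_algebra dest: sets_eq_imp_space_eq)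
  note k = obs_law_kernels[OF \<pi>]
  have "(\<integral>\<^sup>+x. f x \<partial>obs_law CS AS PS PR \<pi>) = (\<integral>\<^sup>+s. \<integral>\<^sup>+x. f x
      \<partial>(\<pi> s \<bind> (\<lambda>a. PR (s, a) \<bind> (\<lambda>r. return (obs_space CS AS) (s, a, r)))) \<partial>PS)"
    unfolding obs_law_def using k(2)
    by (intro nn_integral_bind[OF f] measurable_prob_algebraD)
       (simp add: measurable_cong_sets[OF sPS(1) refl])
  also have "\<dots> = (\<integral>\<^sup>+s. \<integral>\<^sup>+a. \<integral>\<^sup>+r. f (s, a, r) \<partial>PR (s, a) \<partial>\<pi> s \<partial>PS)"
  proof (rule nn_integral_cong)
    fix s assume "s \<in> space PS"
    then have s: "s \<in> space CS" by (simp add: sPS)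
    have s\<pi>: "sets (\<pi> s) = sets AS" "space (\<pi> s) = space AS"
      using measurable_space[OF \<pi> s] by (auto simp: space_prob_algebra dest: sets_eq_imp_space_eq)
    have "(\<integral>\<^sup>+x. f x \<partial>(\<pi> s \<bind> (\<lambda>a. PR (s, a) \<bind> (\<lambda>r. return (obs_space CS AS) (s, a, r))))) =
        (\<integral>\<^sup>+a. \<integral>\<^sup>+x. f x \<partial>(PR (s, a) \<bind> (\<lambda>r. return (obs_space CS AS) (s, a, r))) \<partial>\<pi> s)"
      using measurable_Pair2[OF k(1) s]
      by (intro nn_integral_bind[OF f] measurable_prob_algebraD)
         (simp add: measurable_cong_sets[OF s\<pi>(1) refl])
    also have "\<dots> = (\<integral>\<^sup>+a. \<integral>\<^sup>+r. f (s, a, r) \<partial>PR (s, a) \<partial>\<pi> s)"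
    proof (rule nn_integral_cong)
      fix a assume "a \<in> space (\<pi> s)"
      then have a: "a \<in> space AS" by (simp add: s\<pi>)
      have "PR (s, a) \<in> space (prob_algebra borel)"
        using measurable_space[OF PR, of "(s, a)"] s a by (simp add: space_pair_measure)
      then have sPR: "sets (PR (s, a)) = sets borel" by (simp add: space_prob_algebra)
      have pr: "(\<lambda>r. (s, a, r)) \<in> PR (s, a) \<rightarrow>\<^sub>M obs_space CS AS"
        unfolding measurable_cong_sets[OF sPR refl] using s a by measurable
      have "(\<integral>\<^sup>+x. f x \<partial>(PR (s, a) \<bind> (\<lambda>r. return (obs_space CS AS) (s, a, r)))) =
          (\<integral>\<^sup>+r. \<integral>\<^sup>+x. f x \<partial>return (obs_space CS AS) (s, a, r) \<partial>PR (s, a))"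
        by (intro nn_integral_bind[OF f] measurable_compose[OF pr return_measurable])
      also have "\<dots> = (\<integral>\<^sup>+r. f (s, a, r) \<partial>PR (s, a))"
        using s a by (intro nn_integral_cong nn_integral_return f) (auto simp: space_pair_measure)
      finally show "(\<integral>\<^sup>+x. f x \<partial>(PR (s, a) \<bind> (\<lambda>r. return (obs_space CS AS) (s, a, r)))) = \<dots>" .
    qed
    finally show "(\<integral>\<^sup>+x. f x \<partial>(\<pi> s \<bind> (\<lambda>a. PR (s, a) \<bind> (\<lambda>r. return (obs_space CS AS) (s, a, r))))) = \<dots>" .
  qed
  finally show ?thesis .
qed

lemma prob_accept:
  assumes behavior: "policy_with_density CS AS \<pi>b pb" and target: "policy_with_density CS AS \<pi>e pe"
    and B: "1 \<le> B" "\<And>s a. s \<in> space CS \<Longrightarrow> a \<in> space AS \<Longrightarrow> pe s a \<le> B * pb s a"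
    and E[measurable]: "E \<in> sets (CS \<Otimes>\<^sub>M borel)"
  defines "Q \<equiv> obs_law CS AS PS PR \<pi>b \<Otimes>\<^sub>M uniform_measure lborel {0..1::real}"
  shows "measure Q {z\<in>space Q. (case z of ((s, a, r), v) \<Rightarrow> v \<le> importance_weight pe pb s a / B) \<and>
        (case z of ((s, a, r), v) \<Rightarrow> (s, r)) \<in> E}
    = 1 / B * measure (target_law CS AS PS PR \<pi>e) E"
proof -
  let ?w = "importance_weight pe pb" and ?U = "uniform_measure lborel {0..1::real}"
  let ?b = "obs_law CS AS PS PR \<pi>b" and ?e = "obs_law CS AS PS PR \<pi>e"
  have \<pi>b: "\<pi>b \<in> CS \<rightarrow>\<^sub>M prob_algebra AS" and \<pi>e: "\<pi>e \<in> CS \<rightarrow>\<^sub>M prob_algebra AS"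
    and mb[measurable]: "(\<lambda>(s, a). pb s a) \<in> borel_measurable (CS \<Otimes>\<^sub>M AS)"
    and me[measurable]: "(\<lambda>(s, a). pe s a) \<in> borel_measurable (CS \<Otimes>\<^sub>M AS)"
    and nn: "\<And>s a. s \<in> space CS \<Longrightarrow> a \<in> space AS \<Longrightarrow> 0 \<le> pb s a"
      "\<And>s a. s \<in> space CS \<Longrightarrow> a \<in> space AS \<Longrightarrow> 0 \<le> pe s a"
    and db: "\<And>s. s \<in> space CS \<Longrightarrow> \<pi>b s = density AS (\<lambda>a. ennreal (pb s a))"
    and de: "\<And>s. s \<in> space CS \<Longrightarrow> \<pi>e s = density AS (\<lambda>a. ennreal (pe s a))"
    using behavior target by (auto simp: policy_with_density_def)
  \<comment> \<open>Where \<open>pb\<close> vanishes the bound forces \<open>pe\<close> to vanish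
    too, and the claims hold because the weight is 0 there.\<close>
  have w: "pb s a * (?w s a / B) = 1 / B * pe s a" "0 \<le> ?w s a / B" "?w s a / B \<le> 1"
    if "s \<in> space CS" "a \<in> space AS" for s a
    using B(1) B(2)[OF that] nn[OF that]
    by (auto simp: importance_weight_def divide_simps mult.commute)
  have sb: "sets ?b = sets (obs_space CS AS)" "space ?b = space (obs_space CS AS)"
    and se: "sets ?e = sets (obs_space CS AS)" "space ?e = space (obs_space CS AS)"
    using obs_law_kernels(3)[OF \<pi>b] obs_law_kernels(3)[OF \<pi>e]
    by (auto simp: space_prob_algebra dest: sets_eq_imp_space_eq)
  have sPS: "sets PS = sets CS" "space PS = space CS"
    using PS by (auto simp: space_prob_algebra dest: sets_eq_imp_space_eq)
  interpret U: prob_space ?U by (rule prob_space_uniform_measure) auto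
  have mw[measurable]: "(\<lambda>(s, a, r::real). ?w s a) \<in> borel_measurable (obs_space CS AS)"
    unfolding importance_weight_def case_prod_beta by measurable
  let ?A = "{z\<in>space Q. (case z of ((s, a, r), v) \<Rightarrow> v \<le> ?w s a / B) \<and> (case z of ((s, a, r), v) \<Rightarrow> (s, r)) \<in> E}"
  have sQ: "sets Q = sets (obs_space CS AS \<Otimes>\<^sub>M borel)"
    unfolding Q_def by (intro sets_pair_measure_cong sb) simp
  have mw'[measurable]: "(\<lambda>z. ?w (fst (fst z)) (fst (snd (fst z)))) \<in> borel_measurable Q"
    using measurable_compose[OF measurable_fst mw, of borel]
    unfolding measurable_cong_sets[OF sQ refl] by (simp add: case_prod_beta)
  have mE[measurable]: "(\<lambda>z. (fst (fst z), snd (snd (fst z)))) \<in> Q \<rightarrow>\<^sub>M CS \<Otimes>\<^sub>M borel"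
    unfolding measurable_cong_sets[OF sQ refl] by measurable
  have ms[measurable]: "snd \<in> borel_measurable Q"
    unfolding measurable_cong_sets[OF sQ refl] by measurable
  have A: "?A \<in> sets Q"
    unfolding case_prod_beta by measurable
  have "emeasure Q ?A = (\<integral>\<^sup>+x. emeasure ?U (Pair x -` ?A) \<partial>?b)"
    using A unfolding Q_def by (rule U.emeasure_pair_measure_alt)
  also have "\<dots> = (\<integral>\<^sup>+x. (case x of (s, a, r) \<Rightarrow> ennreal (?w s a / B) * indicator E (s, r)) \<partial>?b)"
  proof (rule nn_integral_cong, safe)
    fix s a r assume x: "(s, a, r) \<in> space ?b"
    then have sa: "s \<in> space CS" "a \<in> space AS" by (auto simp: sb space_pair_measure)
    have "Pair (s, a, r) -` ?A = (if (s, r) \<in> E then {..?w s a / B} else {})"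
      using x by (auto simp: Q_def space_pair_measure)
    moreover have "emeasure ?U {..?w s a / B} = ennreal (?w s a / B)"
    proof -
      have "{0..1} \<inter> {..?w s a / B} = {0..?w s a / B}" using w(3)[OF sa] by auto
      then show ?thesis
        using w(2)[OF sa] divide_ennreal[of "?w s a / B" 1] by simp
    qed
    ultimately show "emeasure ?U (Pair (s, a, r) -` ?A) = ennreal (?w s a / B) * indicator E (s, r)"
      by simp
  qed
  also have "\<dots> = (\<integral>\<^sup>+s. \<integral>\<^sup>+a. \<integral>\<^sup>+r. ennreal (?w s a / B) * indicator E (s, r) \<partial>PR (s, a) \<partial>\<pi>b s \<partial>PS)"
  proof (subst nn_integral_obs_law[OF \<pi>b])
    note [measurable] = mw[unfolded case_prod_beta]
    show "(\<lambda>x. case x of (s, a, r) \<Rightarrow> ennreal (?w s a / B) * indicator E (s, r))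
        \<in> borel_measurable (obs_space CS AS)"
      unfolding case_prod_beta by measurable
  qed simp
  also have "\<dots> = (\<integral>\<^sup>+s. \<integral>\<^sup>+a. \<integral>\<^sup>+r. ennreal (1 / B) * indicator E (s, r) \<partial>PR (s, a) \<partial>\<pi>e s \<partial>PS)"
  proof (rule nn_integral_cong)
    fix s assume "s \<in> space PS"
    then have s: "s \<in> space CS" by (simp add: sPS)
    \<comment> \<open>The reward kernel is common to both policies, so integrating out the reward
      first leaves the same function of the action on both sides.\<close>
    define g where "g a = (\<integral>\<^sup>+r. indicator E (s, r) \<partial>PR (s, a))" for a
    have "(\<lambda>a. PR (s, a)) \<in> AS \<rightarrow>\<^sub>M prob_algebra borel"
      by (rule measurable_compose[OF measurable_Pair1'[OF s] PR])
    then have [measurable]: "g \<in> borel_measurable AS"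
      unfolding g_def using s
      by (intro nn_integral_measurable_subprob_algebra2[where N=borel] measurable_prob_algebraD) measurable
    have mbs[measurable]: "pb s \<in> borel_measurable AS" and mes[measurable]: "pe s \<in> borel_measurable AS"
      using measurable_Pair2[OF mb s] measurable_Pair2[OF me s] by auto
    have [measurable]: "?w s \<in> borel_measurable AS"
      unfolding importance_weight_def by measurable
    have PRs: "sets (PR (s, a)) = sets borel" if "a \<in> space AS" for a
      using measurable_space[OF PR, of "(s, a)"] s that by (simp add: space_pair_measure space_prob_algebra)
    have mEs: "(\<lambda>r. indicator E (s, r) :: ennreal) \<in> borel_measurable (PR (s, a))" if "a \<in> space AS" for a
      unfolding measurable_cong_sets[OF PRs[OF that] refl] using s by measurable
    have "(\<integral>\<^sup>+a. \<integral>\<^sup>+r. ennreal (?w s a / B) * indicator E (s, r) \<partial>PR (s, a) \<partial>\<pi>b s) =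
        (\<integral>\<^sup>+a. ennreal (?w s a / B) * g a \<partial>\<pi>b s)"
      by (intro nn_integral_cong) (simp add: db[OF s] g_def nn_integral_cmult mEs)
    also have "\<dots> = (\<integral>\<^sup>+a. ennreal (pb s a) * (ennreal (?w s a / B) * g a) \<partial>AS)"
      unfolding db[OF s] by (rule nn_integral_density) measurable
    also have "\<dots> = (\<integral>\<^sup>+a. ennreal (pe s a) * (ennreal (1 / B) * g a) \<partial>AS)"
    proof (rule nn_integral_cong)
      fix a assume a: "a \<in> space AS"
      have "ennreal (pb s a) * ennreal (?w s a / B) = ennreal (pe s a) * ennreal (1 / B)"
        using w(1,2)[OF s a] nn[OF s a] B(1)
        by (simp add: mult.commute flip: ennreal_mult)
      then show "ennreal (pb s a) * (ennreal (?w s a / B) * g a) = ennreal (pe s a) * (ennreal (1 / B) * g a)"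
        by (simp flip: mult.assoc)
    qed
    also have "\<dots> = (\<integral>\<^sup>+a. ennreal (1 / B) * g a \<partial>\<pi>e s)"
      unfolding de[OF s] by (rule nn_integral_density[symmetric]) measurable
    also have "\<dots> = (\<integral>\<^sup>+a. \<integral>\<^sup>+r. ennreal (1 / B) * indicator E (s, r) \<partial>PR (s, a) \<partial>\<pi>e s)"
      by (intro nn_integral_cong) (simp add: de[OF s] g_def nn_integral_cmult mEs)
    finally show "(\<integral>\<^sup>+a. \<integral>\<^sup>+r. ennreal (?w s a / B) * indicator E (s, r) \<partial>PR (s, a) \<partial>\<pi>b s) = \<dots>" .
  qed
  also have "\<dots> = (\<integral>\<^sup>+x. ennreal (1 / B) * (case x of (s, a, r) \<Rightarrow> indicator E (s, r)) \<partial>?e)"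
    by (subst nn_integral_obs_law[OF \<pi>e]) (auto simp: case_prod_beta)
  also have "\<dots> = ennreal (1 / B) * (\<integral>\<^sup>+x. (case x of (s, a, r) \<Rightarrow> indicator E (s, r)) \<partial>?e)"
    by (rule nn_integral_cmult) (simp add: measurable_cong_sets[OF se(1) refl])
  also have "(\<integral>\<^sup>+x. (case x of (s, a, r) \<Rightarrow> indicator E (s, r)) \<partial>?e) = emeasure (target_law CS AS PS PR \<pi>e) E"
  proof -
    have m: "(\<lambda>(s, a, r). (s, r)) \<in> ?e \<rightarrow>\<^sub>M CS \<Otimes>\<^sub>M borel"
      unfolding measurable_cong_sets[OF se(1) refl] by measurable
    have "emeasure (target_law CS AS PS PR \<pi>e) E = (\<integral>\<^sup>+x. indicator E x \<partial>target_law CS AS PS PR \<pi>e)"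
      by (simp add: target_law_def)
    also have "\<dots> = (\<integral>\<^sup>+x. indicator E (case x of (s, a, r) \<Rightarrow> (s, r)) \<partial>?e)"
      unfolding target_law_def using m by (subst nn_integral_distr) auto
    finally show ?thesis by (simp add: case_prod_beta)
  qed
  finally have "emeasure Q ?A = ennreal (1 / B) * emeasure (target_law CS AS PS PR \<pi>e) E" .
  then show ?thesis
    using B(1) by (simp add: measure_def enn2real_mult)
qed

end

section \<open>The prediction interval\<close>

lemma procedure_interval_miss_iff:
  assumes "0 \<le> \<delta>"
  shows "r \<notin> procedure_interval n w B qhat pos \<epsilon>lo \<epsilon>up \<epsilon> \<delta> d v u s \<longleftrightarrow>
    (let xs = accepted_sample n (\<lambda>((s, a, r), v). v \<le> w s a / B) (\<lambda>((s, a, r), v). (s, r))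
        (\<lambda>i\<in>{..<n}. (d i, v i))
     in miscovers (\<lambda>tr. conformity_score (qhat \<epsilon>lo tr) (qhat \<epsilon>up tr))
       (\<lambda>M. nat (pac_index M \<epsilon> \<delta> + 1)) xs (pos (length xs) u) (s, r))"
proof -
  have "accepted_sample n (\<lambda>((s, a, r), v). v \<le> w s a / B) (\<lambda>((s, a, r), v). (s, r))
        (\<lambda>i\<in>{..<n}. (d i, v i)) = rejection_sample n w B d v"
    unfolding accepted_sample_def rejection_sample_def
    by (rule map_cong[OF filter_cong]) (auto simp: case_prod_beta)
  then show ?thesis
    by (simp add: procedure_interval_def pac_interval_def Let_def miscovers_def
        not_in_prediction_interval_iff[OF assms] filter_map o_def)
qed

theorem theorem1:
  fixes \<Omega> :: "'w measure" and CS :: "'s measure" and AS :: "'a measure" and MU :: "'u measure"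
    and PS :: "'s measure" and PR :: "'s \<times> 'a \<Rightarrow> real measure"
    and \<pi>b \<pi>e :: "'s \<Rightarrow> 'a measure" and pb pe :: "'s \<Rightarrow> 'a \<Rightarrow> real"
    and D :: "nat \<Rightarrow> 'w \<Rightarrow> 's \<times> 'a \<times> real" and V :: "nat \<Rightarrow> 'w \<Rightarrow> real" and U :: "'w \<Rightarrow> 'u"
    and T :: "'w \<Rightarrow> 's \<times> real"
    and qhat :: "real \<Rightarrow> ('s \<times> real) list \<Rightarrow> 's \<Rightarrow> real" and pos :: "nat \<Rightarrow> 'u \<Rightarrow> nat set"
    and \<epsilon> \<delta> \<gamma> \<epsilon>lo \<epsilon>up :: real and n :: nat
  defines "w \<equiv> importance_weight pe pb"
    and "B \<equiv> real_of_ereal (weight_bound CS AS pe pb)"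
  defines "Dn \<equiv> \<lambda>\<omega>. \<lambda>i\<in>{..<n}. D i \<omega>" and "Vn \<equiv> \<lambda>\<omega>. \<lambda>i\<in>{..<n}. V i \<omega>"
    and "MD \<equiv> \<Pi>\<^sub>M i\<in>{..<n}. obs_space CS AS" and "MV \<equiv> \<Pi>\<^sub>M i\<in>{..<n}. (borel :: real measure)"
  assumes "prob_space \<Omega>"
    and PS: "PS \<in> space (prob_algebra CS)"
    and PR: "PR \<in> CS \<Otimes>\<^sub>M AS \<rightarrow>\<^sub>M prob_algebra borel"
    and behavior: "policy_with_density CS AS \<pi>b pb"
    and target: "policy_with_density CS AS \<pi>e pe"
    and bounded: "weight_bound CS AS pe pb < \<infinity>"
    and levels: "0 < \<epsilon>" "\<epsilon> < 1" "0 < \<delta>" "\<delta> < 1" "0 < \<gamma>" "\<gamma> < 1"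
    and quantile_levels: "\<epsilon>lo \<in> {0..1}" "\<epsilon>up \<in> {0..1}" "\<epsilon>up - \<epsilon>lo = 1 - \<epsilon>"
    and n: "n \<ge> 1"
    and algorithm: "measurable_algorithm CS (qhat \<epsilon>lo)" "measurable_algorithm CS (qhat \<epsilon>up)"
    and split: "split_rule \<gamma> MU pos"
    and D_indep: "prob_space.indep_vars \<Omega> (\<lambda>_. obs_space CS AS) D {..<n}"
    and D_law: "\<And>i. i < n \<Longrightarrow> distr \<Omega> (obs_space CS AS) (D i) = obs_law CS AS PS PR \<pi>b"
    and V_indep: "prob_space.indep_vars \<Omega> (\<lambda>_. borel) V {..<n}"
    and V_law: "\<And>i. i < n \<Longrightarrow> distr \<Omega> borel (V i) = uniform_measure lborel {0..1}"
    and D_V_indep: "indep_elements \<Omega> MD Dn MV Vn"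
    and U_indep: "indep_elements \<Omega> (MD \<Otimes>\<^sub>M MV) (\<lambda>\<omega>. (Dn \<omega>, Vn \<omega>)) MU U"
    and T_indep: "indep_elements \<Omega>
      (MD \<Otimes>\<^sub>M (MV \<Otimes>\<^sub>M MU)) (\<lambda>\<omega>. (Dn \<omega>, Vn \<omega>, U \<omega>)) (CS \<Otimes>\<^sub>M borel) T"
    and T_law: "distr \<Omega> (CS \<Otimes>\<^sub>M borel) T = target_law CS AS PS PR \<pi>e"
  defines "C \<equiv> \<lambda>\<omega>. procedure_interval n w B qhat pos \<epsilon>lo \<epsilon>up \<epsilon> \<delta> (Dn \<omega>) (Vn \<omega>) (U \<omega>)"
  defines "L \<equiv> miscoverage \<Omega> (MD \<Otimes>\<^sub>M (MV \<Otimes>\<^sub>M MU)) (\<lambda>\<omega>. (Dn \<omega>, Vn \<omega>, U \<omega>)) T C"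
  shows "measure \<Omega> {\<omega> \<in> space \<Omega>. L \<omega> \<le> \<epsilon>} \<ge> 1 - \<delta>"
proof -
  interpret prob_space \<Omega> by fact
  let ?MZ = "MD \<Otimes>\<^sub>M (MV \<Otimes>\<^sub>M MU)" and ?Z = "\<lambda>\<omega>. (Dn \<omega>, Vn \<omega>, U \<omega>)"
  define P where "P = target_law CS AS PS PR \<pi>e"
  define \<mu> where "\<mu> = obs_law CS AS PS PR \<pi>b"
  define \<nu> where "\<nu> = uniform_measure lborel {0..1::real}"
  define Q where "Q = \<mu> \<Otimes>\<^sub>M \<nu>"
  define acc where "acc = (\<lambda>((s::'s, a::'a, r::real), v). v \<le> w s a / B)"
  define X where "X = (\<lambda>((s::'s, a::'a, r::real), v::real). (s, r))"
  define score where "score tr = conformity_score (qhat \<epsilon>lo tr) (qhat \<epsilon>up tr)" for tr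
  define c where "c M = nat (pac_index M \<epsilon> \<delta> + 1)" for M
  define zip where "zip d v = (\<lambda>i\<in>{..<n}. (d i, v i))" for d :: "nat \<Rightarrow> 's \<times> 'a \<times> real" and v :: "nat \<Rightarrow> real"
  define xs where "xs = accepted_sample n acc X"
  define miss where "miss d v u t \<longleftrightarrow> miscovers score c (xs (zip d v)) (pos (length (xs (zip d v))) u) t"
    for d v u t
  have miss: "snd t \<notin> procedure_interval n w B qhat pos \<epsilon>lo \<epsilon>up \<epsilon> \<delta> d v u (fst t) \<longleftrightarrow> miss d v u t"
    for d v u t
    using procedure_interval_miss_iff[of \<delta> "snd t" n w B qhat pos \<epsilon>lo \<epsilon>up \<epsilon> d v u "fst t"] levels
    by (simp add: miss_def xs_def acc_def X_def score_def[abs_def] c_def[abs_def] zip_def Let_def)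

  have \<pi>b: "\<pi>b \<in> CS \<rightarrow>\<^sub>M prob_algebra AS"
    and mb[measurable]: "(\<lambda>(s, a). pb s a) \<in> borel_measurable (CS \<Otimes>\<^sub>M AS)"
    and me[measurable]: "(\<lambda>(s, a). pe s a) \<in> borel_measurable (CS \<Otimes>\<^sub>M AS)"
    using behavior target by (auto simp: policy_with_density_def)
  have \<mu>: "prob_space \<mu>" "sets \<mu> = sets (obs_space CS AS)"
    using obs_law_kernels(3)[OF PS PR \<pi>b] by (auto simp: \<mu>_def space_prob_algebra)
  have \<nu>: "prob_space \<nu>" "sets \<nu> = sets borel"
    by (auto simp: \<nu>_def intro!: prob_space_uniform_measure)
  have sP: "sets P = sets (CS \<Otimes>\<^sub>M borel)" "space P = space (CS \<Otimes>\<^sub>M borel)"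
    by (simp_all add: P_def target_law_def)
  have T[measurable]: "T \<in> \<Omega> \<rightarrow>\<^sub>M CS \<Otimes>\<^sub>M borel" and Z[measurable]: "?Z \<in> \<Omega> \<rightarrow>\<^sub>M ?MZ"
    and U[measurable]: "U \<in> \<Omega> \<rightarrow>\<^sub>M MU"
    and Dn[measurable]: "Dn \<in> \<Omega> \<rightarrow>\<^sub>M MD" and Vn[measurable]: "Vn \<in> \<Omega> \<rightarrow>\<^sub>M MV"
    using T_indep U_indep D_V_indep by (auto simp: indep_elements_def)
  have P: "prob_space P" unfolding P_def T_law[symmetric] by (rule prob_space_distr) simp
  interpret P: prob_space P by (rule P)
  have Q: "prob_space Q"
  proof -
    interpret \<mu>: prob_space \<mu> by (rule \<mu>)
    interpret \<nu>: prob_space \<nu> by (rule \<nu>)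
    interpret \<mu>\<nu>: pair_prob_space \<mu> \<nu> ..
    show ?thesis unfolding Q_def by (rule \<mu>\<nu>.prob_space_axioms)
  qed
  have sQ: "sets Q = sets (obs_space CS AS \<Otimes>\<^sub>M borel)"
    unfolding Q_def by (intro sets_pair_measure_cong \<mu> \<nu>)

  have "space CS \<noteq> {}"
    using PS prob_space.not_empty sets_eq_imp_space_eq unfolding space_prob_algebra by blast
  then have B: "1 \<le> B" "\<And>s a. s \<in> space CS \<Longrightarrow> a \<in> space AS \<Longrightarrow> pe s a \<le> B * pb s a"
    using weight_bound_real[OF behavior target _ bounded] by (simp_all add: B_def)
  have score0: "(\<lambda>(x, y). score (map x [0..<m]) y)
      \<in> borel_measurable ((\<Pi>\<^sub>M i\<in>{..<m}. CS \<Otimes>\<^sub>M borel) \<Otimes>\<^sub>M (CS \<Otimes>\<^sub>M borel))" for m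
  proof -
    have *: "(\<lambda>p. qhat e (map (fst p) [0..<m]) (fst (snd p)))
        \<in> borel_measurable ((\<Pi>\<^sub>M i\<in>{..<m}. CS \<Otimes>\<^sub>M borel) \<Otimes>\<^sub>M (CS \<Otimes>\<^sub>M (borel :: real measure)))"
      if "measurable_algorithm CS (qhat e)" for e
    proof -
      have 1: "(\<lambda>p. (fst p, fst (snd p))) \<in> (\<Pi>\<^sub>M i\<in>{..<m}. CS \<Otimes>\<^sub>M borel) \<Otimes>\<^sub>M (CS \<Otimes>\<^sub>M (borel :: real measure))
          \<rightarrow>\<^sub>M (\<Pi>\<^sub>M i\<in>{..<m}. CS \<Otimes>\<^sub>M borel) \<Otimes>\<^sub>M CS"
        by measurable
      have 2: "(\<lambda>p. qhat e (map (fst p) [0..<m]) (snd p))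
          \<in> borel_measurable ((\<Pi>\<^sub>M i\<in>{..<m}. CS \<Otimes>\<^sub>M borel) \<Otimes>\<^sub>M CS)"
        using that unfolding measurable_algorithm_def case_prod_unfold by blast
      show ?thesis using measurable_compose[OF 1 2] by simp
    qed
    note [measurable] = *[OF algorithm(1)] *[OF algorithm(2)]
    show ?thesis
      unfolding score_def conformity_score_def case_prod_beta by measurable
  qed
  have score: "(\<lambda>(x, y). score (map x [0..<m]) y) \<in> borel_measurable ((\<Pi>\<^sub>M i\<in>{..<m}. P) \<Otimes>\<^sub>M P)" for m
  proof -
    have "sets ((\<Pi>\<^sub>M i\<in>{..<m}. P) \<Otimes>\<^sub>M P) =
        sets ((\<Pi>\<^sub>M i\<in>{..<m}. CS \<Otimes>\<^sub>M borel) \<Otimes>\<^sub>M (CS \<Otimes>\<^sub>M borel))"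
      by (intro sets_pair_measure_cong sets_PiM_cong refl sP)
    from measurable_cong_sets[OF this refl] score0 show ?thesis by blast
  qed
  have acc0: "Measurable.pred (obs_space CS AS \<Otimes>\<^sub>M borel) acc"
  proof -
    have [measurable]: "(\<lambda>(s, a). w s a) \<in> borel_measurable (CS \<Otimes>\<^sub>M AS)"
      unfolding w_def importance_weight_def case_prod_beta by measurable
    show ?thesis unfolding acc_def case_prod_beta by measurable
  qed
  have X0: "X \<in> obs_space CS AS \<Otimes>\<^sub>M borel \<rightarrow>\<^sub>M CS \<Otimes>\<^sub>M borel"
    unfolding X_def case_prod_beta by measurable
  have acc: "Measurable.pred Q acc" and X: "X \<in> Q \<rightarrow>\<^sub>M P"
    using acc0 X0 measurable_cong_sets[OF sQ sP(1)] measurable_cong_sets[OF sQ refl] by blast+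

  define J where "J m = {J. J \<subseteq> {..<m} \<and> card J = nat \<lceil>\<gamma> * real m\<rceil>}" for m
  have pos: "pos m \<in> MU \<rightarrow>\<^sub>M count_space (J m)" "finite (J m)" for m
    using split by (auto simp: split_rule_def J_def)
  \<comment> \<open>Miscoverage as one event in data, seed and test point jointly: conditioning and
    Fubini both work with its sections.\<close>
  define E where "E = {p \<in> space (?MZ \<Otimes>\<^sub>M (CS \<Otimes>\<^sub>M borel)).
    miss (fst (fst p)) (fst (snd (fst p))) (snd (snd (fst p))) (snd p)}"
  have E[measurable]: "E \<in> sets (?MZ \<Otimes>\<^sub>M (CS \<Otimes>\<^sub>M borel))"
  proof -
    let ?N = "?MZ \<Otimes>\<^sub>M (CS \<Otimes>\<^sub>M (borel :: real measure))"
    have "Measurable.pred ?N (\<lambda>\<omega>. miscovers score c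
      (accepted_sample n acc X (zip (fst (fst \<omega>)) (fst (snd (fst \<omega>)))))
      ((\<lambda>m \<omega>. pos m (snd (snd (fst \<omega>)))) (length (accepted_sample n acc X (zip (fst (fst \<omega>)) (fst (snd (fst \<omega>)))))) \<omega>)
      (snd \<omega>))"
    proof (rule pred_miscovers[OF score0 _ acc0 X0 _ pos(2)])
      show "(\<lambda>\<omega>. zip (fst (fst \<omega>)) (fst (snd (fst \<omega>))) i) \<in> ?N \<rightarrow>\<^sub>M obs_space CS AS \<Otimes>\<^sub>M borel"
        if "i < n" for i
        using that unfolding zip_def MD_def MV_def by simp
      show "(\<lambda>\<omega>. pos m (snd (snd (fst \<omega>)))) \<in> ?N \<rightarrow>\<^sub>M count_space (J m)" for m
        using pos(1) by measurable
    qed measurable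
    then show ?thesis by (simp add: E_def miss_def xs_def pred_def)
  qed
  then have E'[measurable]: "E \<in> sets (?MZ \<Otimes>\<^sub>M P)"
    using sets_pair_measure_cong[OF refl sP(1)] by blast
  \<comment> \<open>An explicit version of the miscoverage as a function of everything used to build
    the interval; \<open>L\<close> agrees with it almost everywhere, which is enough for the final
    probability.\<close>
  define \<rho> where "\<rho> z = measure P (Pair z -` E)" for z
  have \<rho>[measurable]: "\<rho> \<in> borel_measurable ?MZ"
    using P.measurable_emeasure_Pair[OF E'] unfolding \<rho>_def measure_def by measurable
  have AE: "AE \<omega> in \<Omega>. L \<omega> = \<rho> (?Z \<omega>)"
  proof -
    have "{\<omega>\<in>space \<Omega>. snd (T \<omega>) \<notin> C \<omega> (fst (T \<omega>))} = {\<omega>\<in>space \<Omega>. (?Z \<omega>, T \<omega>) \<in> E}"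
      using measurable_space[OF T] measurable_space[OF Z]
      by (auto simp: C_def miss E_def space_pair_measure)
    then show ?thesis
      using real_cond_exp_indicator_indep_elements[OF prob_space_axioms T_indep E]
      by (simp add: L_def miscoverage_def \<rho>_def P_def T_law)
  qed
  have L[measurable]: "L \<in> borel_measurable \<Omega>"
    by (simp add: L_def miscoverage_def)

  let ?PD = "PiM {..<n} (\<lambda>_. \<mu>)" and ?PV = "PiM {..<n} (\<lambda>_. \<nu>)"
  \<comment> \<open>This is where \<open>n \<ge> 1\<close> enters: independence is turned into a
    product law over a nonempty index set.\<close>
  have "{..<n} \<noteq> {}" using n by (auto simp: lessThan_empty_iff)
  have PD: "distr \<Omega> MD Dn = ?PD"
  proof -
    have "D i \<in> \<Omega> \<rightarrow>\<^sub>M obs_space CS AS" if "i < n" for i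
      using D_indep that by (auto simp: indep_vars_def)
    then have "distr \<Omega> MD Dn = (\<Pi>\<^sub>M i\<in>{..<n}. distr \<Omega> (obs_space CS AS) (D i))"
      using D_indep indep_vars_iff_distr_eq_PiM'[OF \<open>{..<n} \<noteq> {}\<close>, of D "\<lambda>_. obs_space CS AS"]
      by (simp add: MD_def Dn_def)
    also have "\<dots> = ?PD" by (intro PiM_cong) (auto simp: D_law \<mu>_def)
    finally show ?thesis .
  qed
  have PV: "distr \<Omega> MV Vn = ?PV"
  proof -
    have "V i \<in> borel_measurable \<Omega>" if "i < n" for i
      using V_indep that by (auto simp: indep_vars_def)
    then have "distr \<Omega> MV Vn = (\<Pi>\<^sub>M i\<in>{..<n}. distr \<Omega> borel (V i))"
      using V_indep indep_vars_iff_distr_eq_PiM'[OF \<open>{..<n} \<noteq> {}\<close>, of V "\<lambda>_. borel"]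
      by (simp add: MV_def Vn_def)
    also have "\<dots> = ?PV" by (intro PiM_cong) (auto simp: V_law \<nu>_def)
    finally show ?thesis .
  qed
  let ?PU = "distr \<Omega> MU U"
  have law: "distr \<Omega> ((MD \<Otimes>\<^sub>M MV) \<Otimes>\<^sub>M MU) (\<lambda>\<omega>. ((Dn \<omega>, Vn \<omega>), U \<omega>)) = (?PD \<Otimes>\<^sub>M ?PV) \<Otimes>\<^sub>M ?PU"
    using distr_pair_indep_elements[OF prob_space_axioms U_indep]
      distr_pair_indep_elements[OF prob_space_axioms D_V_indep]
    by (simp add: PD PV)
  interpret PU: prob_space ?PU by (rule prob_space_distr) simp
  interpret PiD: prob_space ?PD by (intro prob_space_PiM \<mu>)
  interpret PiV: prob_space ?PV by (intro prob_space_PiM \<nu>)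
  interpret PDV: pair_prob_space ?PD ?PV ..
  interpret PDVU: pair_prob_space "?PD \<Otimes>\<^sub>M ?PV" ?PU ..
  have sD: "sets ?PD = sets MD" and sV: "sets ?PV = sets MV"
    unfolding MD_def MV_def by (intro sets_PiM_cong refl \<mu> \<nu>)+
  note space_DV = sets_eq_imp_space_eq[OF sD] sets_eq_imp_space_eq[OF sV]
  \<comment> \<open>The triple is bracketed with the seed split off last, matching
    \<open>U_indep\<close>, while \<rho> takes the bracketing of \<open>T_indep\<close>.\<close>
  define bad where "bad = {p\<in>space ((MD \<Otimes>\<^sub>M MV) \<Otimes>\<^sub>M MU). \<epsilon> < \<rho> (fst (fst p), snd (fst p), snd p)}"
  have "bad \<in> sets ((MD \<Otimes>\<^sub>M MV) \<Otimes>\<^sub>M MU)" unfolding bad_def by measurable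
  then have bad: "bad \<in> sets ((?PD \<Otimes>\<^sub>M ?PV) \<Otimes>\<^sub>M ?PU)"
    using sets_pair_measure_cong[OF sets_pair_measure_cong[OF sD sV] sets_distr[of \<Omega> MU U]] by blast
  \<comment> \<open>With the seed frozen, the positions depend on the sample size only, so the bound
    for deterministic splits applies to each section with \<open>q = 1 / B\<close>.\<close>
  have slice: "emeasure (?PD \<Otimes>\<^sub>M ?PV) ((\<lambda>x. (x, u)) -` bad) \<le> ennreal \<delta>" if u: "u \<in> space MU" for u
  proof -
    let ?badQ = "{z\<in>space (PiM {..<n} (\<lambda>_. Q)). \<epsilon> < measure P {x\<in>space P.
      miscovers score c (accepted_sample n acc X z) (pos (length (accepted_sample n acc X z)) u) x}}"
    have accept: "measure Q {z\<in>space Q. acc z \<and> X z \<in> F} = 1 / B * measure P F" if "F \<in> sets P" for F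
      using prob_accept[OF PS PR behavior target B, of F] that
      by (simp add: acc_def X_def Q_def \<mu>_def \<nu>_def P_def w_def sP[unfolded P_def] case_prod_unfold)
    have cb: "measure_pmf.prob (binomial_pmf M \<epsilon>) {..<c M} \<le> \<delta>" for M
      using pac_index(3)[of \<delta> M \<epsilon>] levels by (simp add: c_def)
    note bnd = prob_miscoverage_gt_le[OF Q P score acc X accept levels(1,2) cb, of n "\<lambda>m. pos m u"]
    have zipm: "(\<lambda>(x, y). \<lambda>i\<in>{..<n}. (x i, y i)) \<in> ?PD \<Otimes>\<^sub>M ?PV \<rightarrow>\<^sub>M PiM {..<n} (\<lambda>_. Q)"
      unfolding Q_def by measurable
    have "(\<lambda>x. (x, u)) -` bad = (\<lambda>(x, y). \<lambda>i\<in>{..<n}. (x i, y i)) -` ?badQ \<inter> space (?PD \<Otimes>\<^sub>M ?PV)"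
    proof (intro set_eqI, clarify)
      fix d v
      have "Pair (d, v, u) -` E = {x\<in>space P. miscovers score c (accepted_sample n acc X (zip d v))
          (pos (length (accepted_sample n acc X (zip d v))) u) x}" if "(d, v) \<in> space (?PD \<Otimes>\<^sub>M ?PV)"
        using that u by (auto simp: E_def space_DV sP space_pair_measure miss_def xs_def)
      moreover have "zip d v \<in> space (PiM {..<n} (\<lambda>_. Q))" if "(d, v) \<in> space (?PD \<Otimes>\<^sub>M ?PV)"
        using measurable_space[OF zipm that] by (simp add: zip_def)
      ultimately show "(d, v) \<in> (\<lambda>x. (x, u)) -` bad \<longleftrightarrow>
          (d, v) \<in> (\<lambda>(x, y). \<lambda>i\<in>{..<n}. (x i, y i)) -` ?badQ \<inter> space (?PD \<Otimes>\<^sub>M ?PV)"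
        using u by (auto simp: bad_def \<rho>_def zip_def space_DV space_pair_measure)
    qed
    then have "emeasure (?PD \<Otimes>\<^sub>M ?PV) ((\<lambda>x. (x, u)) -` bad) =
        emeasure (distr (?PD \<Otimes>\<^sub>M ?PV) (PiM {..<n} (\<lambda>_. Q)) (\<lambda>(x, y). \<lambda>i\<in>{..<n}. (x i, y i))) ?badQ"
      by (simp only: emeasure_distr[OF zipm bnd(1)])
    also have "\<dots> = emeasure (PiM {..<n} (\<lambda>_. Q)) ?badQ"
      unfolding Q_def by (simp only: distr_PiM_pair_zip[OF finite_lessThan \<mu>(1) \<nu>(1)])
    also have "\<dots> \<le> ennreal \<delta>"
    proof -
      interpret N: prob_space "PiM {..<n} (\<lambda>_. Q)" by (intro prob_space_PiM Q)
      show ?thesis using bnd(2) by (simp add: N.emeasure_eq_measure ennreal_leI)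
    qed
    finally show ?thesis .
  qed
  have "emeasure \<Omega> {\<omega>\<in>space \<Omega>. \<epsilon> < \<rho> (?Z \<omega>)} =
      emeasure (distr \<Omega> ((MD \<Otimes>\<^sub>M MV) \<Otimes>\<^sub>M MU) (\<lambda>\<omega>. ((Dn \<omega>, Vn \<omega>), U \<omega>))) bad"
    using measurable_space[OF Dn] measurable_space[OF Vn] measurable_space[OF U]
      \<open>bad \<in> sets ((MD \<Otimes>\<^sub>M MV) \<Otimes>\<^sub>M MU)\<close>
    by (subst emeasure_distr) (auto simp: bad_def space_pair_measure intro!: arg_cong[where f="emeasure \<Omega>"])
  also have "\<dots> = (\<integral>\<^sup>+u. emeasure (?PD \<Otimes>\<^sub>M ?PV) ((\<lambda>x. (x, u)) -` bad) \<partial>?PU)"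
    unfolding law by (rule PDVU.emeasure_pair_measure_alt2[OF bad])
  also have "\<dots> \<le> (\<integral>\<^sup>+u. ennreal \<delta> \<partial>?PU)"
    by (intro nn_integral_mono slice) simp
  also have "\<dots> = ennreal \<delta>" by (simp add: PU.emeasure_space_1[simplified])
  finally have "prob {\<omega>\<in>space \<Omega>. \<epsilon> < \<rho> (?Z \<omega>)} \<le> \<delta>"
    using levels by (simp add: emeasure_eq_measure)
  moreover have "prob {\<omega>\<in>space \<Omega>. L \<omega> \<le> \<epsilon>} = prob (space \<Omega> - {\<omega>\<in>space \<Omega>. \<epsilon> < \<rho> (?Z \<omega>)})"
    by (rule finite_measure_eq_AE) (use AE in auto)
  ultimately show ?thesis by (simp add: prob_compl)
qed

end
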